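(* For every $\beta>1$ and Lebesgue-a.e. $\alpha\in[0,1]$, the $G_{\alpha,\beta}$-orbit $\{G_{\alpha,\beta}^n(0): n\ge 0\}$ of the point $0$ is dense in $V_{\alpha,\beta}$.
   Context: For $\alpha\in[0,1]$ and $\beta>1$, the generalised $\beta$-transformation is $G_{\alpha,\beta}:[0,1]\to[0,1]$, $G_{\alpha,\beta}(x)=\beta x+\alpha \pmod 1$. It may be viewed as a map of the circle $[0,1]/\!\sim$ with $0\sim 1$, where it has the single discontinuity point $c=0=1$. The set $V_{\alpha,\beta}$ denotes the unique smallest (forward) invariant union of non-trivial intervals of $G_{\alpha,\beta}$ (non-trivial meaning of positive length, and invariant meaning $G_{\alpha,\beta}(V_{\alpha,\beta})\subset V_{\alpha,\beta}$); such a set exists for every $\beta>1$ and $\alpha\in[0,1]$. *)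

theory Defs
  imports "HOL-Analysis.Analysis"
begin

text \<open>The generalised \<open>\<beta>\<close>-transformation. The representative modulo 1 is taken in \<open>[0,1)\<close>, so
  the value at the discontinuity \<open>c = 0 = 1\<close> of the circle map is the right limit \<open>\<alpha>\<close> (mod 1).
  It is a total function on the reals; only its values on \<open>[0,1]\<close> matter.\<close>

definition gbeta :: "real \<Rightarrow> real \<Rightarrow> real \<Rightarrow> real" where
  "gbeta \<alpha> \<beta> x = frac (\<beta> * x + \<alpha>)"

definition nontrivial_interval :: "real set \<Rightarrow> bool" where
  "nontrivial_interval I \<longleftrightarrow> is_interval I \<and> (\<exists>a\<in>I. \<exists>b\<in>I. a < b)"

text \<open>The union is required to be nonempty: otherwise the smallest such set would be \<open>{}\<close>. The
  family of intervals may be infinite, and each interval may be open, closed or half-open.\<close>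

definition invariant_interval_union :: "real \<Rightarrow> real \<Rightarrow> real set \<Rightarrow> bool" where
  "invariant_interval_union \<alpha> \<beta> V \<longleftrightarrow>
     V \<noteq> {} \<and>
     (\<exists>\<I>. (\<forall>I\<in>\<I>. nontrivial_interval I \<and> I \<subseteq> {0..1}) \<and> V = \<Union>\<I>) \<and>
     gbeta \<alpha> \<beta> ` V \<subseteq> V"

text \<open>\<open>LEAST\<close> is with respect to inclusion.\<close>

definition V_set :: "real \<Rightarrow> real \<Rightarrow> real set" where
  "V_set \<alpha> \<beta> = (LEAST V. invariant_interval_union \<alpha> \<beta> V)"

definition gbeta_orbit :: "real \<Rightarrow> real \<Rightarrow> real \<Rightarrow> real set" where
  "gbeta_orbit \<alpha> \<beta> x = {(gbeta \<alpha> \<beta> ^^ n) x | n. n \<ge> 0}"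

end

theory Submission
  imports Defs
begin

text \<open>
  Fix \<open>\<beta>\<close> and write \<open>G\<^sub>\<alpha>\<close> for the map. On the set of parameters sharing the first \<open>n\<close> digits of the
  orbit of \<open>0\<close>, the function \<open>\<alpha> \<mapsto> G\<^sub>\<alpha>\<^sup>n(0)\<close> is affine with slope \<open>1 + \<beta> + \<dots> + \<beta>^(n - 1)\<close>. The proof
  transfers the expansion of \<open>G\<^sub>\<alpha>\<close> in phase space to these parameter branches.

  Large images. For all but countably many \<open>\<alpha>\<close> neither one-sided orbit of the discontinuity returns
  to the discontinuity. Near such an \<open>\<alpha>\<close>, a branch with a short image that is cut falls into two
  parts with images next to the discontinuity, and these are not cut again for a prescribed number
  \<open>M\<close> of steps. If \<open>\<beta>^M > 2\<close>, branches that stay short multiply more slowly than their lengths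
  shrink, so almost every \<open>\<alpha>\<close> lies, for infinitely many \<open>n\<close>, on a branch whose image has length at least
  some \<open>\<delta> > 0\<close> (\<open>negligible_not_large_images\<close>).

  The least invariant set. The same growth argument for a single \<open>\<alpha>\<close> shows that every invariant
  union of intervals contains a left or a right neighbourhood of the discontinuity of uniform
  length. This yields one interval common to all invariant sets, and the set it generates is the
  least one (\<open>V_set_least\<close>). It contains \<open>0\<close>, hence the whole orbit. By minimality, it is contained
  in the set generated by any nontrivial half-open interval in \<open>[0,1]\<close>.

  Density. Let the orbit of \<open>0\<close> under \<open>G\<^sub>\<alpha>\<close> avoid an open set \<open>U\<close> meeting the least invariant set.
  A large image at time \<open>n\<close> contains one of finitely many fixed intervals, and a fixed part of that
  interval is mapped into \<open>U\<close> after a bounded time, also for parameters near \<open>\<alpha>\<close>. Pulled back along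
  the affine branch, this part becomes a hole, of proportional size, in the set of parameters whose
  orbit avoids \<open>U\<close>. Thus that set is porous at \<open>\<alpha>\<close> (\<open>avoiding_set_porous\<close>), and the points at which
  a set is porous form a null subset of it (\<open>negligible_porous_points\<close>).
\<close>

section \<open>Porous points of a set of reals\<close>

text \<open>Porosity at \<open>x\<close> in the upper sense: holes of proportion \<open>\<eta>\<close> are required at arbitrarily small
  scales \<open>r\<close>, and they may lie anywhere in the ball around \<open>x\<close>.\<close>

definition porous_at :: "real \<Rightarrow> real set \<Rightarrow> real \<Rightarrow> bool" where
  "porous_at \<eta> A x \<longleftrightarrow> (\<forall>d>0. \<exists>r u. 0 < r \<and> r < d \<and>
     {u<..<u + \<eta> * r} \<subseteq> cball x r \<and> {u<..<u + \<eta> * r} \<inter> A = {})"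

lemma porous_at_mono:
  assumes "porous_at \<eta> A x" "\<eta>' \<le> \<eta>" "B \<subseteq> A"
  shows "porous_at \<eta>' B x"
  unfolding porous_at_def
proof (intro allI impI)
  fix d :: real assume "d > 0"
  then obtain r u where r: "0 < r" "r < d" "{u<..<u + \<eta> * r} \<subseteq> cball x r" "{u<..<u + \<eta> * r} \<inter> A = {}"
    using assms(1) unfolding porous_at_def by blast
  have "\<eta>' * r \<le> \<eta> * r" using assms(2) r by (intro mult_right_mono) auto
  then have "{u<..<u + \<eta>' * r} \<subseteq> {u<..<u + \<eta> * r}"
    by auto
  then show "\<exists>r u. 0 < r \<and> r < d \<and> {u<..<u + \<eta>' * r} \<subseteq> cball x r \<and> {u<..<u + \<eta>' * r} \<inter> B = {}"
    using r assms(3) by blast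
qed

text \<open>A Vitali subfamily of the balls witnessing porosity covers \<open>S\<close> up to a null set inside \<open>T\<close>.
  Removing the holes, which miss \<open>S\<close>, multiplies the measure of this disjoint cover by
  \<open>1 - \<eta> / 2\<close>, because a ball of radius \<open>r\<close> on the line has length \<open>2 * r\<close>.\<close>

lemma porous_cover_shrink:
  fixes S T :: "real set"
  assumes eta: "0 < \<eta>" "\<eta> \<le> 2"
    and por: "\<And>x. x \<in> S \<Longrightarrow> porous_at \<eta> S x"
    and T: "open T" "S \<subseteq> T"
  obtains T' where "T' \<in> sets lebesgue" "S \<subseteq> T'"
    "emeasure lebesgue T' \<le> ennreal (1 - \<eta> / 2) * emeasure lebesgue T"
proof -
  define K where "K = {(x, r). x \<in> S \<and> 0 < r \<and> cball x r \<subseteq> T \<and>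
      (\<exists>u. {u<..<u + \<eta> * r} \<subseteq> cball x r \<and> {u<..<u + \<eta> * r} \<inter> S = {})}"
  have fine: "\<exists>i. i \<in> K \<and> x \<in> cball (fst i) (snd i) \<and> snd i < d" if x: "x \<in> S" and d: "0 < d" for x d
  proof -
    obtain \<epsilon> where \<epsilon>: "\<epsilon> > 0" "cball x \<epsilon> \<subseteq> T"
      using T x open_contains_cball by blast
    obtain r u where r: "0 < r" "r < min d \<epsilon>"
      "{u<..<u + \<eta> * r} \<subseteq> cball x r" "{u<..<u + \<eta> * r} \<inter> S = {}"
      using por[OF x] d \<epsilon>(1) unfolding porous_at_def by (metis min_less_iff_conj)
    have "cball x r \<subseteq> T"
      using r \<epsilon> by (meson min_less_iff_conj less_imp_le subset_cball subset_trans)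
    then have "(x, r) \<in> K"
      using r x unfolding K_def by blast
    then show ?thesis
      using r by (intro exI[of _ "(x, r)"]) auto
  qed
  have "0 < snd i" if "i \<in> K" for i
    using that by (auto simp: K_def)
  from Vitali_covering_theorem_cballs[of K snd S fst, OF this fine]
  obtain C where C: "countable C" "C \<subseteq> K"
    and pw: "pairwise (\<lambda>i j. disjnt (cball (fst i) (snd i)) (cball (fst j) (snd j))) C"
    and neg: "negligible (S - (\<Union>i\<in>C. cball (fst i) (snd i)))"
    by blast
  define B where "B i = cball (fst i) (snd i)" for i :: "real \<times> real"
  have "\<forall>i\<in>C. \<exists>u. {u<..<u + \<eta> * snd i} \<subseteq> B i \<and> {u<..<u + \<eta> * snd i} \<inter> S = {}"
    using C(2) by (auto simp: K_def B_def)
  then obtain u where u: "\<And>i. i \<in> C \<Longrightarrow> {u i<..<u i + \<eta> * snd i} \<subseteq> B i"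
      "\<And>i. i \<in> C \<Longrightarrow> {u i<..<u i + \<eta> * snd i} \<inter> S = {}"
    by metis
  define H where "H i = {u i<..<u i + \<eta> * snd i}" for i
  define N where "N = S - (\<Union>i\<in>C. B i)"
  define T' where "T' = N \<union> (\<Union>i\<in>C. B i - H i)"
  have dis: "disjoint_family_on B C"
    using pw by (auto simp: disjoint_family_on_def pairwise_def disjnt_def B_def)
  then have dis': "disjoint_family_on (\<lambda>i. B i - H i) C"
    unfolding disjoint_family_on_def by blast
  have setsB: "B i \<in> sets lebesgue" and setsH: "H i \<in> sets lebesgue" for i
    by (auto simp: B_def H_def)
  have N: "N \<in> null_sets lebesgue"
    using neg by (simp add: N_def B_def negligible_iff_null_sets)
  have UB: "(\<Union>i\<in>C. B i) \<subseteq> T"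
    using C(2) by (force simp: K_def B_def)
  \<comment> \<open>deleting its hole costs every ball the same proportion of its measure\<close>
  have one: "emeasure lebesgue (B i - H i) = ennreal (1 - \<eta> / 2) * emeasure lebesgue (B i)" if "i \<in> C" for i
  proof -
    have pos: "snd i > 0" using C(2) that by (auto simp: K_def)
    have Beq: "B i = {fst i - snd i .. fst i + snd i}"
      by (simp add: B_def cball_eq_atLeastAtMost)
    have eB: "emeasure lebesgue (B i) = ennreal (2 * snd i)"
      using pos by (simp add: Beq)
    have eH: "emeasure lebesgue (H i) = ennreal (\<eta> * snd i)"
      using pos eta by (simp add: H_def)
    have "emeasure lebesgue (B i - H i) = emeasure lebesgue (B i) - emeasure lebesgue (H i)"
      using u(1)[OF that] eH setsB setsH by (intro emeasure_Diff) (auto simp: H_def)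
    also have "\<dots> = ennreal (2 * snd i - \<eta> * snd i)"
      using eB eH pos eta by (simp add: ennreal_minus)
    also have "2 * snd i - \<eta> * snd i = (1 - \<eta> / 2) * (2 * snd i)"
      by (simp add: algebra_simps)
    also have "ennreal \<dots> = ennreal (1 - \<eta> / 2) * emeasure lebesgue (B i)"
      using eB eta pos by (simp add: ennreal_mult)
    finally show ?thesis .
  qed
  have "emeasure lebesgue (\<Union>i\<in>C. B i - H i) = (\<integral>\<^sup>+i. emeasure lebesgue (B i - H i) \<partial>count_space C)"
    using C(1) dis' setsB setsH by (intro emeasure_UN_countable) auto
  also have "\<dots> = (\<integral>\<^sup>+i. ennreal (1 - \<eta> / 2) * emeasure lebesgue (B i) \<partial>count_space C)"
    by (intro nn_integral_cong) (simp add: one)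
  also have "\<dots> = ennreal (1 - \<eta> / 2) * (\<integral>\<^sup>+i. emeasure lebesgue (B i) \<partial>count_space C)"
    by (intro nn_integral_cmult) auto
  also have "(\<integral>\<^sup>+i. emeasure lebesgue (B i) \<partial>count_space C) = emeasure lebesgue (\<Union>i\<in>C. B i)"
    using C(1) dis setsB by (intro emeasure_UN_countable[symmetric]) auto
  also have "ennreal (1 - \<eta> / 2) * \<dots> \<le> ennreal (1 - \<eta> / 2) * emeasure lebesgue T"
    using UB T(1) by (intro mult_left_mono emeasure_mono) auto
  finally have le: "emeasure lebesgue (\<Union>i\<in>C. B i - H i) \<le> ennreal (1 - \<eta> / 2) * emeasure lebesgue T" .
  have sets: "(\<Union>i\<in>C. B i - H i) \<in> sets lebesgue"
    using C(1) setsB setsH by (intro sets.countable_UN') auto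
  show ?thesis
  proof (rule that)
    show "T' \<in> sets lebesgue"
      using N sets unfolding T'_def by auto
    show "S \<subseteq> T'"
      using u(2) by (fastforce simp: T'_def N_def H_def)
    show "emeasure lebesgue T' \<le> ennreal (1 - \<eta> / 2) * emeasure lebesgue T"
      using le emeasure_Un_null_set[OF sets N] by (simp add: T'_def Un_commute)
  qed
qed

text \<open>Repeated shrinking makes the measure of a cover decay geometrically. Open covers are needed to
  shrink again, and the intermediate ratio \<open>q' > q\<close> pays for returning to an open set.\<close>

lemma negligible_porous_bounded:
  fixes S :: "real set"
  assumes eta: "0 < \<eta>" "\<eta> \<le> 2" and "bounded S"
    and por: "\<And>x. x \<in> S \<Longrightarrow> porous_at \<eta> S x"
  shows "negligible S"
proof -
  define q where "q = 1 - \<eta> / 2"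
  have q: "0 \<le> q" "q < 1" using eta by (auto simp: q_def)
  obtain R where R: "S \<subseteq> ball 0 R" "R > 0"
    using \<open>bounded S\<close> bounded_subset_ballD by blast
  define c where "c = 2 * R"
  define q' where "q' = (1 + q) / 2"
  have q': "q < q'" "0 < q'" "q' < 1" using q by (auto simp: q'_def)
  have cover: "\<exists>T. open T \<and> S \<subseteq> T \<and> emeasure lebesgue T \<le> ennreal (c * q' ^ n)" for n
  proof (induction n)
    case 0
    show ?case
      using R by (intro exI[of _ "ball 0 R"]) (simp add: ball_eq_greaterThanLessThan c_def)
  next
    case (Suc n)
    then obtain T where T: "open T" "S \<subseteq> T" "emeasure lebesgue T \<le> ennreal (c * q' ^ n)" by blast
    obtain T' where T': "T' \<in> sets lebesgue" "S \<subseteq> T'"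
      "emeasure lebesgue T' \<le> ennreal q * emeasure lebesgue T"
      using porous_cover_shrink[OF eta por T(1,2)] unfolding q_def by metis
    define e where "e = (q' - q) * (c * q' ^ n)"
    have e: "e > 0" using q' R by (simp add: e_def c_def)
    obtain T'' where T'': "open T''" "T' \<subseteq> T''" "T'' - T' \<in> lmeasurable"
      "emeasure lebesgue (T'' - T') < ennreal e"
      using sets_lebesgue_outer_open[OF T'(1) e] by blast
    have "emeasure lebesgue T'' = emeasure lebesgue (T' \<union> (T'' - T'))"
      using T'' by (simp add: Un_absorb1)
    also have "\<dots> \<le> emeasure lebesgue T' + emeasure lebesgue (T'' - T')"
      using T'(1) T''(3) by (intro emeasure_subadditive) auto
    also have "\<dots> \<le> ennreal q * ennreal (c * q' ^ n) + ennreal e"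
      using T''(4) by (intro add_mono order_trans[OF T'(3)] mult_left_mono T(3)) auto
    also have "\<dots> = ennreal (q * (c * q' ^ n) + e)"
      using q q' R e by (simp add: ennreal_mult c_def)
    also have "q * (c * q' ^ n) + e = c * q' ^ Suc n"
      by (simp add: e_def algebra_simps)
    finally show ?case
      using T'' T' by blast
  qed
  show ?thesis
    unfolding negligible_outer_le
  proof (intro allI impI)
    fix e :: real assume "e > 0"
    have "(\<lambda>n. c * q' ^ n) \<longlonglongrightarrow> c * 0"
      using q' by (intro tendsto_intros LIMSEQ_power_zero) auto
    then have "\<forall>\<^sub>F n in sequentially. c * q' ^ n < e"
      using \<open>e > 0\<close> by (auto dest: order_tendstoD)
    then obtain n where n: "c * q' ^ n < e"
      by (auto simp: eventually_sequentially)
    obtain T where T: "open T" "S \<subseteq> T" "emeasure lebesgue T \<le> ennreal (c * q' ^ n)"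
      using cover by blast
    have "T \<in> lmeasurable"
      using T by (intro fmeasurableI) (auto simp: top.not_eq_extremum le_less_trans)
    moreover have "measure lebesgue T \<le> c * q' ^ n"
      using T(3) q' R by (simp add: measure_def enn2real_leI c_def)
    ultimately show "\<exists>T. S \<subseteq> T \<and> T \<in> lmeasurable \<and> measure lebesgue T \<le> e"
      using T n by (intro exI[of _ T]) auto
  qed
qed

text \<open>Takes the place of the Lebesgue density theorem in the main argument. The ratio \<open>\<eta>\<close> may depend
  on the point, because the ratios \<open>1 / real (Suc k)\<close> suffice.\<close>

lemma negligible_porous_points:
  fixes A :: "real set"
  shows "negligible {x \<in> A. \<exists>\<eta>>0. porous_at \<eta> A x}"
proof -
  define S where "S k = {x \<in> A. porous_at (1 / real (Suc k)) A x} \<inter> cball 0 (real k)" for k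
  have "negligible (S k)" for k
  proof (rule negligible_porous_bounded[of "1 / real (Suc k)"])
    show "1 / real (Suc k) \<le> 2" by (simp add: divide_le_eq)
    show "bounded (S k)" by (simp add: S_def bounded_Int)
    show "porous_at (1 / real (Suc k)) (S k) x" if "x \<in> S k" for x
    proof -
      have "porous_at (1 / real (Suc k)) A x" using that by (simp add: S_def)
      moreover have "S k \<subseteq> A" by (auto simp: S_def)
      ultimately show ?thesis by (rule porous_at_mono[OF _ order_refl])
    qed
  qed simp
  then have "negligible (\<Union>k. S k)"
    by (intro negligible_countable_Union) auto
  moreover have "{x \<in> A. \<exists>\<eta>>0. porous_at \<eta> A x} \<subseteq> (\<Union>k. S k)"
  proof safe
    fix x \<eta> :: real assume x: "x \<in> A" "\<eta> > 0" "porous_at \<eta> A x"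
    obtain k :: nat where k: "real k \<ge> max (1 / \<eta>) \<bar>x\<bar>"
      using real_arch_simple by blast
    have "1 / \<eta> \<le> real (Suc k)" using k by simp
    then have le: "1 / real (Suc k) \<le> \<eta>"
      using x(2) by (simp add: field_simps)
    then have "porous_at (1 / real (Suc k)) A x"
      by (rule porous_at_mono[OF x(3) _ order_refl])
    then show "x \<in> (\<Union>k. S k)"
      using x(1) k by (auto simp: S_def)
  qed
  ultimately show ?thesis
    by (rule negligible_subset)
qed

section \<open>Itineraries and affine branches\<close>

definition digit :: "real \<Rightarrow> real \<Rightarrow> real \<Rightarrow> nat \<Rightarrow> int" where
  "digit \<beta> \<alpha> z j = \<lfloor>\<beta> * (gbeta \<alpha> \<beta> ^^ j) z + \<alpha>\<rfloor>"

text \<open>The itinerary of \<open>z\<close> up to time \<open>n\<close>. Parameters with the same word of length \<open>n\<close> lie on one branch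
  of the piecewise affine map \<open>\<alpha> \<mapsto> G\<^sub>\<alpha>\<^sup>n(0)\<close>.\<close>

definition word :: "real \<Rightarrow> real \<Rightarrow> real \<Rightarrow> nat \<Rightarrow> int list" where
  "word \<beta> \<alpha> z n = map (digit \<beta> \<alpha> z) [0..<n]"

text \<open>The slope of each branch of \<open>\<alpha> \<mapsto> G\<^sub>\<alpha>\<^sup>n(0)\<close>.\<close>

definition geom :: "real \<Rightarrow> nat \<Rightarrow> real" where
  "geom \<beta> n = (\<Sum>i<n. \<beta> ^ i)"

lemma geom_Suc: "geom \<beta> (Suc n) = \<beta> * geom \<beta> n + 1"
  by (simp add: geom_def sum.lessThan_Suc_shift sum_distrib_left del: sum.lessThan_Suc)

lemma geom_nonneg: "1 < \<beta> \<Longrightarrow> 0 \<le> geom \<beta> n"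
  by (simp add: geom_def sum_nonneg)

lemma geom_ge_1: "1 < \<beta> \<Longrightarrow> 1 \<le> n \<Longrightarrow> 1 \<le> geom \<beta> n"
  by (cases n) (auto simp: geom_Suc geom_nonneg)

lemma geom_ge_power: "1 < \<beta> \<Longrightarrow> \<beta> ^ n \<le> geom \<beta> (Suc n)"
  by (simp add: geom_def sum_nonneg)

lemma gbeta_Suc_frac: "(gbeta \<alpha> \<beta> ^^ Suc n) z = frac (\<beta> * (gbeta \<alpha> \<beta> ^^ n) z + \<alpha>)"
  unfolding funpow.simps o_apply by (subst gbeta_def) (rule refl)

lemma gbeta_Suc:
  "(gbeta \<alpha> \<beta> ^^ Suc n) z = \<beta> * (gbeta \<alpha> \<beta> ^^ n) z + \<alpha> - of_int (digit \<beta> \<alpha> z n)"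
  by (simp only: gbeta_Suc_frac digit_def frac_def)

lemma gbeta_01: "0 \<le> gbeta \<alpha> \<beta> x" "gbeta \<alpha> \<beta> x < 1"
  by (auto simp: gbeta_def frac_lt_1)

lemma funpow_gbeta_01:
  assumes "0 \<le> z" "z < 1"
  shows "0 \<le> (gbeta \<alpha> \<beta> ^^ n) z" "(gbeta \<alpha> \<beta> ^^ n) z < 1"
  using assms by (cases n; simp add: gbeta_01)+

lemma word_eq_iff: "word \<beta> \<alpha> z n = word \<beta> \<alpha>' z' n \<longleftrightarrow> (\<forall>j<n. digit \<beta> \<alpha> z j = digit \<beta> \<alpha>' z' j)"
  by (auto simp: word_def)

lemma word_eq_mono: "word \<beta> \<alpha> z n = word \<beta> \<alpha>' z' n \<Longrightarrow> m \<le> n \<Longrightarrow> word \<beta> \<alpha> z m = word \<beta> \<alpha>' z' m"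
  by (auto simp: word_eq_iff)

lemma digit_shift: "digit \<beta> \<alpha> ((gbeta \<alpha> \<beta> ^^ n) z) j = digit \<beta> \<alpha> z (n + j)"
  unfolding digit_def by (subst add.commute) (simp add: funpow_add)

text \<open>Affinity of the branches jointly in the parameter and the starting point: \<open>z = z'\<close> gives the
  expansion in the parameter, \<open>\<alpha> = \<alpha>'\<close> the one in phase space.\<close>

lemma iterate_diff:
  assumes "word \<beta> \<alpha> z n = word \<beta> \<alpha>' z' n"
  shows "(gbeta \<alpha> \<beta> ^^ n) z - (gbeta \<alpha>' \<beta> ^^ n) z' = \<beta> ^ n * (z - z') + geom \<beta> n * (\<alpha> - \<alpha>')"
  using assms
proof (induction n)
  case 0
  then show ?case by (simp add: geom_def)
next
  case (Suc n)
  have IH: "(gbeta \<alpha> \<beta> ^^ n) z - (gbeta \<alpha>' \<beta> ^^ n) z' = \<beta> ^ n * (z - z') + geom \<beta> n * (\<alpha> - \<alpha>')"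
    using Suc by (auto simp: word_eq_iff)
  have d: "digit \<beta> \<alpha> z n = digit \<beta> \<alpha>' z' n"
    using Suc.prems by (auto simp: word_eq_iff)
  have "(gbeta \<alpha> \<beta> ^^ Suc n) z - (gbeta \<alpha>' \<beta> ^^ Suc n) z'
      = \<beta> * ((gbeta \<alpha> \<beta> ^^ n) z - (gbeta \<alpha>' \<beta> ^^ n) z') + (\<alpha> - \<alpha>')"
    unfolding gbeta_Suc d by (simp add: algebra_simps)
  then show ?case
    unfolding IH geom_Suc by (simp add: algebra_simps)
qed

text \<open>Parameters on one branch form an interval, because the numbers whose floors are taken increase
  with the parameter as long as the digits agree.\<close>

lemma word_convex:
  assumes \<beta>: "1 < \<beta>" and "\<alpha> \<le> \<gamma>" "\<gamma> \<le> \<alpha>'" and "word \<beta> \<alpha> z n = word \<beta> \<alpha>' z n"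
  shows "word \<beta> \<gamma> z n = word \<beta> \<alpha> z n"
  using assms(4)
proof (induction n)
  case 0
  then show ?case by (simp add: word_def)
next
  case (Suc n)
  have eq: "word \<beta> \<alpha> z n = word \<beta> \<alpha>' z n" "digit \<beta> \<alpha> z n = digit \<beta> \<alpha>' z n"
    using Suc.prems by (auto simp: word_eq_iff)
  have IH: "word \<beta> \<gamma> z n = word \<beta> \<alpha> z n"
    using Suc.IH eq by blast
  have "geom \<beta> n \<ge> 0" by (rule geom_nonneg[OF \<beta>])
  then have "0 \<le> geom \<beta> n * (\<gamma> - \<alpha>)" "0 \<le> geom \<beta> n * (\<alpha>' - \<gamma>)"
    using assms(2,3) by simp_all
  then have "(gbeta \<alpha> \<beta> ^^ n) z \<le> (gbeta \<gamma> \<beta> ^^ n) z" "(gbeta \<gamma> \<beta> ^^ n) z \<le> (gbeta \<alpha>' \<beta> ^^ n) z"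
    using iterate_diff[OF IH] iterate_diff[of \<beta> \<alpha>' z n \<gamma> z] IH eq(1)
    by simp_all
  then have "digit \<beta> \<alpha> z n \<le> digit \<beta> \<gamma> z n" "digit \<beta> \<gamma> z n \<le> digit \<beta> \<alpha>' z n"
    using assms(2,3) \<beta> unfolding digit_def by (intro floor_mono add_mono mult_left_mono; simp)+
  then show ?case
    using IH eq(2) by (auto simp: word_eq_iff less_Suc_eq)
qed

text \<open>As long as the orbit of \<open>z\<close> avoids \<open>0\<close> from time 1 on, every floor that is taken is that of a
  non-integer, hence locally constant in the parameter and in the point.\<close>

lemma iterate_stable:
  assumes \<beta>: "1 < \<beta>" and "\<And>j. 1 \<le> j \<Longrightarrow> j \<le> m \<Longrightarrow> (gbeta \<alpha> \<beta> ^^ j) z \<noteq> 0" and "0 < e"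
  shows "\<exists>s>0. \<forall>\<alpha>' z'. \<bar>\<alpha>' - \<alpha>\<bar> < s \<longrightarrow> \<bar>z' - z\<bar> < s \<longrightarrow>
           word \<beta> \<alpha>' z' m = word \<beta> \<alpha> z m \<and> \<bar>(gbeta \<alpha>' \<beta> ^^ m) z' - (gbeta \<alpha> \<beta> ^^ m) z\<bar> < e"
  using assms(2,3)
proof (induction m arbitrary: e)
  case 0
  then show ?case by (auto simp: word_def)
next
  case (Suc m)
  define v where "v = \<beta> * (gbeta \<alpha> \<beta> ^^ m) z + \<alpha>"
  have "frac v \<noteq> 0"
    using Suc.prems(1)[of "Suc m"] unfolding gbeta_Suc_frac v_def by simp
  then have fv: "0 < frac v" "frac v < 1"
    using frac_ge_0[of v] frac_lt_1[of v] by linarith+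
  define t where "t = min e (min (frac v) (1 - frac v))"
  have t: "t > 0" using fv Suc.prems(2) by (simp add: t_def)
  obtain s where s: "s > 0" "\<And>\<alpha>' z'. \<bar>\<alpha>' - \<alpha>\<bar> < s \<Longrightarrow> \<bar>z' - z\<bar> < s \<Longrightarrow>
      word \<beta> \<alpha>' z' m = word \<beta> \<alpha> z m \<and> \<bar>(gbeta \<alpha>' \<beta> ^^ m) z' - (gbeta \<alpha> \<beta> ^^ m) z\<bar> < t / (2 * \<beta>)"
    using Suc.IH[of "t / (2 * \<beta>)"] Suc.prems(1) t \<beta> by auto
  show ?case
  proof (intro exI[of _ "min s (t / 2)"] conjI allI impI)
    show "0 < min s (t / 2)" using s t by simp
    fix \<alpha>' z' assume a: "\<bar>\<alpha>' - \<alpha>\<bar> < min s (t / 2)" "\<bar>z' - z\<bar> < min s (t / 2)"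
    then have w: "word \<beta> \<alpha>' z' m = word \<beta> \<alpha> z m"
      and d: "\<bar>(gbeta \<alpha>' \<beta> ^^ m) z' - (gbeta \<alpha> \<beta> ^^ m) z\<bar> < t / (2 * \<beta>)"
      using s(2)[of \<alpha>' z'] by auto
    define v' where "v' = \<beta> * (gbeta \<alpha>' \<beta> ^^ m) z' + \<alpha>'"
    have "\<bar>\<beta> * ((gbeta \<alpha>' \<beta> ^^ m) z' - (gbeta \<alpha> \<beta> ^^ m) z)\<bar> < \<beta> * (t / (2 * \<beta>))"
      using d \<beta> unfolding abs_mult by (simp add: mult_strict_left_mono del: times_divide_eq_right)
    also have "\<dots> = t / 2" using \<beta> by simp
    finally have "\<bar>\<beta> * ((gbeta \<alpha>' \<beta> ^^ m) z' - (gbeta \<alpha> \<beta> ^^ m) z) + (\<alpha>' - \<alpha>)\<bar> < t"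
      using a(1) by linarith
    moreover have "\<beta> * ((gbeta \<alpha>' \<beta> ^^ m) z' - (gbeta \<alpha> \<beta> ^^ m) z) + (\<alpha>' - \<alpha>) = v' - v"
      by (simp add: v_def v'_def algebra_simps)
    ultimately have vv: "\<bar>v' - v\<bar> < t" by simp
    then have fl: "\<lfloor>v'\<rfloor> = \<lfloor>v\<rfloor>"
      unfolding t_def frac_def by (intro floor_unique) linarith+
    show "word \<beta> \<alpha>' z' (Suc m) = word \<beta> \<alpha> z (Suc m)"
      using w fl by (auto simp: word_eq_iff less_Suc_eq v_def v'_def digit_def)
    show "\<bar>(gbeta \<alpha>' \<beta> ^^ Suc m) z' - (gbeta \<alpha> \<beta> ^^ Suc m) z\<bar> < e"
      using vv fl unfolding gbeta_Suc_frac v_def[symmetric] v'_def[symmetric]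
      by (simp add: frac_def t_def)
  qed
qed

text \<open>For each of the countably many words, the orbit point is an affine function of \<open>\<alpha>\<close> with positive
  slope, so that it vanishes for at most one parameter.\<close>

lemma countable_hit_zero:
  assumes \<beta>: "1 < \<beta>"
  shows "countable {\<alpha>. \<exists>j\<ge>1. (gbeta \<alpha> \<beta> ^^ j) z = 0}"
proof -
  have "countable {\<alpha>. (gbeta \<alpha> \<beta> ^^ j) z = 0}" if "j \<ge> 1" for j
  proof (rule countable_image_inj_on)
    show "countable ((\<lambda>\<alpha>. word \<beta> \<alpha> z j) ` {\<alpha>. (gbeta \<alpha> \<beta> ^^ j) z = 0})"
      by (rule countableI_type)
    show "inj_on (\<lambda>\<alpha>. word \<beta> \<alpha> z j) {\<alpha>. (gbeta \<alpha> \<beta> ^^ j) z = 0}"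
    proof (rule inj_onI)
      fix \<alpha> \<alpha>' assume "\<alpha> \<in> {\<alpha>. (gbeta \<alpha> \<beta> ^^ j) z = 0}" "\<alpha>' \<in> {\<alpha>. (gbeta \<alpha> \<beta> ^^ j) z = 0}"
        and "word \<beta> \<alpha> z j = word \<beta> \<alpha>' z j"
      then have "geom \<beta> j * (\<alpha> - \<alpha>') = 0"
        using iterate_diff[of \<beta> \<alpha> z j \<alpha>' z] by simp
      then show "\<alpha> = \<alpha>'"
        using geom_ge_1[OF \<beta> that] by simp
    qed
  qed
  then have "countable (\<Union>j\<in>{1..}. {\<alpha>. (gbeta \<alpha> \<beta> ^^ j) z = 0})"
    by (intro countable_UN) auto
  then show ?thesis
    by (rule countable_subset[rotated]) auto
qed

section \<open>Branches with large images\<close>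

text \<open>The words \<open>w0\<close> and \<open>w1\<close> are the initial itineraries common to all points close to the right,
  respectively left, of the discontinuity \<open>0 = 1\<close> of the circle. If a set of parameters sharing a
  word has short images, then its first cut leaves two parts, whose images sit next to \<open>1\<close> and next
  to \<open>0\<close>. From then on these two parts follow \<open>w1\<close> and \<open>w0\<close> and cannot be cut again for \<open>M\<close> steps.
  The factor \<open>\<beta> + 1\<close> bounds the stretching from time \<open>m\<close> to the numbers \<open>v \<alpha>\<close> whose floors are
  compared.\<close>

lemma short_piece_two_words:
  assumes \<beta>: "1 < \<beta>" and s: "0 < s" "s \<le> 1/2" and n: "1 \<le> n"
    and w0: "\<And>\<alpha> z. \<alpha> \<in> B \<Longrightarrow> \<bar>z\<bar> < s \<Longrightarrow> word \<beta> \<alpha> z M = w0"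
    and w1: "\<And>\<alpha> z. \<alpha> \<in> B \<Longrightarrow> \<bar>z - 1\<bar> < s \<Longrightarrow> word \<beta> \<alpha> z M = w1"
    and short: "\<And>m \<alpha> \<alpha>'. \<lbrakk>n \<le> m; \<alpha> \<in> B; \<alpha>' \<in> B; word \<beta> \<alpha> 0 m = word \<beta> \<alpha>' 0 m\<rbrakk> \<Longrightarrow>
                  geom \<beta> m * \<bar>\<alpha> - \<alpha>'\<bar> * (\<beta> + 1) < s"
  shows "\<exists>a b. \<forall>\<alpha>\<in>B. word \<beta> \<alpha> 0 n = w \<longrightarrow> word \<beta> \<alpha> 0 (n + M) \<in> {a, b}"
proof -
  define S where "S = {\<alpha> \<in> B. word \<beta> \<alpha> 0 n = w}"
  define X where "X m \<alpha> = (gbeta \<alpha> \<beta> ^^ m) 0" for m \<alpha>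
  show ?thesis
  proof (cases "\<forall>\<alpha>\<in>S. \<forall>\<alpha>'\<in>S. word \<beta> \<alpha> 0 (n + M) = word \<beta> \<alpha>' 0 (n + M)")
    case True
    then have "\<exists>a. \<forall>\<alpha>\<in>S. word \<beta> \<alpha> 0 (n + M) = a"
      by metis
    then show ?thesis
      unfolding S_def by blast
  next
    case False
    \<comment> \<open>the first time \<open>m\<close> at which two points of the piece are separated by the discontinuity\<close>
    define P where "P m \<longleftrightarrow> (\<exists>\<alpha>\<in>S. \<exists>\<alpha>'\<in>S. word \<beta> \<alpha> 0 (Suc m) \<noteq> word \<beta> \<alpha>' 0 (Suc m))" for m
    have "M \<noteq> 0"
    proof
      assume "M = 0"
      then show False using False by (simp add: S_def)
    qed
    then have "P (n + M - 1)"
      using False by (auto simp: P_def)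
    then have PL: "P (LEAST m. P m)" by (rule LeastI)
    define m where "m = (LEAST m. P m)"
    have m_le: "m \<le> n + M - 1" unfolding m_def by (rule Least_le) fact
    have Pm: "P m" using PL by (simp add: m_def)
    have n_le: "n \<le> m"
    proof (rule ccontr)
      assume "\<not> n \<le> m"
      then have le: "Suc m \<le> n" by simp
      have "word \<beta> \<alpha> 0 (Suc m) = word \<beta> \<alpha>' 0 (Suc m)" if "\<alpha> \<in> S" "\<alpha>' \<in> S" for \<alpha> \<alpha>'
        by (rule word_eq_mono[OF _ le]) (use that in \<open>simp add: S_def\<close>)
      then show False using Pm unfolding P_def by blast
    qed
    have same: "word \<beta> \<alpha> 0 m = word \<beta> \<alpha>' 0 m" if "\<alpha> \<in> S" "\<alpha>' \<in> S" for \<alpha> \<alpha>'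
    proof -
      have "\<not> P (m - 1)" using not_less_Least[of "m - 1" P] n_le n by (simp add: m_def)
      moreover have "Suc (m - 1) = m" using n_le n by simp
      ultimately show ?thesis using that unfolding P_def by metis
    qed
    define v where "v \<alpha> = \<beta> * X m \<alpha> + \<alpha>" for \<alpha>
    have dig: "digit \<beta> \<alpha> 0 m = \<lfloor>v \<alpha>\<rfloor>" for \<alpha> by (simp add: digit_def v_def X_def)
    have X_Suc: "X (Suc m) \<alpha> = v \<alpha> - \<lfloor>v \<alpha>\<rfloor>" for \<alpha>
      unfolding X_def gbeta_Suc dig by (simp add: v_def X_def)
    have close: "\<bar>v \<alpha> - v \<alpha>'\<bar> < s" if "\<alpha> \<in> S" "\<alpha>' \<in> S" for \<alpha> \<alpha>'
    proof -
      have X_diff: "X m \<alpha> - X m \<alpha>' = geom \<beta> m * (\<alpha> - \<alpha>')"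
        using iterate_diff[OF same[OF that]] by (simp add: X_def)
      have "v \<alpha> - v \<alpha>' = \<beta> * (X m \<alpha> - X m \<alpha>') + (\<alpha> - \<alpha>')"
        by (simp add: v_def algebra_simps)
      also have "\<dots> = (\<beta> * geom \<beta> m + 1) * (\<alpha> - \<alpha>')"
        unfolding X_diff by (simp add: algebra_simps)
      finally have "\<bar>v \<alpha> - v \<alpha>'\<bar> = (\<beta> * geom \<beta> m + 1) * \<bar>\<alpha> - \<alpha>'\<bar>"
        using geom_nonneg[OF \<beta>, of m] \<beta> by (simp add: abs_mult)
      also have "\<dots> \<le> (geom \<beta> m * (\<beta> + 1)) * \<bar>\<alpha> - \<alpha>'\<bar>"
        using geom_ge_1[OF \<beta>, of m] n n_le by (intro mult_right_mono) (auto simp: algebra_simps)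
      also have "\<dots> < s"
        using short[OF n_le _ _ same[OF that]] that by (simp add: S_def algebra_simps)
      finally show ?thesis .
    qed
    have tail: "word \<beta> \<alpha> 0 (n + M) = word \<beta> \<alpha>' 0 (n + M)"
      if "\<alpha> \<in> S" "\<alpha>' \<in> S" "\<lfloor>v \<alpha>\<rfloor> = \<lfloor>v \<alpha>'\<rfloor>" "word \<beta> \<alpha> (X (Suc m) \<alpha>) M = word \<beta> \<alpha>' (X (Suc m) \<alpha>') M" for \<alpha> \<alpha>'
      unfolding word_eq_iff
    proof (intro allI impI)
      fix j assume j: "j < n + M"
      consider "j < m" | "j = m" | "j > m" by linarith
      then show "digit \<beta> \<alpha> 0 j = digit \<beta> \<alpha>' 0 j"
      proof cases
        case 1
        then show ?thesis using same[OF that(1,2)] by (simp add: word_eq_iff)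
      next
        case 2
        then show ?thesis using that(3) by (simp add: dig)
      next
        case 3
        then have "j - Suc m < M" using j n_le by linarith
        then have "digit \<beta> \<alpha> (X (Suc m) \<alpha>) (j - Suc m) = digit \<beta> \<alpha>' (X (Suc m) \<alpha>') (j - Suc m)"
          using that(4) by (simp add: word_eq_iff)
        then show ?thesis
          using 3 unfolding X_def digit_shift by simp
      qed
    qed
    obtain \<alpha>1 \<alpha>2 where ex: "\<alpha>1 \<in> S" "\<alpha>2 \<in> S" "\<lfloor>v \<alpha>1\<rfloor> < \<lfloor>v \<alpha>2\<rfloor>"
    proof -
      obtain a b where ab: "a \<in> S" "b \<in> S" "word \<beta> a 0 (Suc m) \<noteq> word \<beta> b 0 (Suc m)"
        using Pm by (auto simp: P_def)
      then have "\<lfloor>v a\<rfloor> \<noteq> \<lfloor>v b\<rfloor>"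
        using same[OF ab(1,2)] by (auto simp: word_eq_iff less_Suc_eq dig)
      then show ?thesis using that ab by (metis linorder_neqE)
    qed
    \<comment> \<open>at time \<open>Suc m\<close>, every point of the piece is next to \<open>1\<close> like \<open>\<alpha>1\<close>, or next to \<open>0\<close> like \<open>\<alpha>2\<close>\<close>
    have "word \<beta> \<alpha> 0 (n + M) \<in> {word \<beta> \<alpha>1 0 (n + M), word \<beta> \<alpha>2 0 (n + M)}" if \<alpha>: "\<alpha> \<in> S" for \<alpha>
    proof -
      have c: "\<bar>v \<alpha>1 - v \<alpha>2\<bar> < s" "\<bar>v \<alpha> - v \<alpha>2\<bar> < s" "\<bar>v \<alpha> - v \<alpha>1\<bar> < s"
        using close ex \<alpha> by auto
      consider "\<lfloor>v \<alpha>\<rfloor> = \<lfloor>v \<alpha>1\<rfloor>" | "\<lfloor>v \<alpha>\<rfloor> = \<lfloor>v \<alpha>2\<rfloor>"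
        using c ex(3) s(2) by linarith
      then show ?thesis
      proof cases
        case 1
        have "\<bar>X (Suc m) \<alpha> - 1\<bar> < s" "\<bar>X (Suc m) \<alpha>1 - 1\<bar> < s"
          unfolding X_Suc using 1 c ex(3) by linarith+
        then have "word \<beta> \<alpha> 0 (n + M) = word \<beta> \<alpha>1 0 (n + M)"
          using 1 \<alpha> ex w1 by (intro tail) (auto simp: S_def)
        then show ?thesis by simp
      next
        case 2
        have "\<bar>X (Suc m) \<alpha>\<bar> < s" "\<bar>X (Suc m) \<alpha>2\<bar> < s"
          unfolding X_Suc using 2 c ex(3) by linarith+
        then have "word \<beta> \<alpha> 0 (n + M) = word \<beta> \<alpha>2 0 (n + M)"
          using 2 \<alpha> ex w0 by (intro tail) (auto simp: S_def)
        then show ?thesis by simp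
      qed
    qed
    then show ?thesis unfolding S_def by blast
  qed
qed

lemma finite_words:
  assumes \<beta>: "1 < \<beta>" and "bounded K"
  shows "finite ((\<lambda>\<alpha>. word \<beta> \<alpha> 0 n) ` K)"
proof -
  obtain R where R: "\<And>\<alpha>. \<alpha> \<in> K \<Longrightarrow> \<bar>\<alpha>\<bar> \<le> R"
    using \<open>bounded K\<close> by (auto simp: bounded_iff)
  have "digit \<beta> \<alpha> 0 j \<in> {\<lfloor>- R\<rfloor>..\<lfloor>\<beta> + R\<rfloor>}" if "\<alpha> \<in> K" for \<alpha> j
  proof -
    have "0 \<le> \<beta> * (gbeta \<alpha> \<beta> ^^ j) 0" "\<beta> * (gbeta \<alpha> \<beta> ^^ j) 0 \<le> \<beta> * 1"
      using funpow_gbeta_01[where z = 0 and \<alpha> = \<alpha> and \<beta> = \<beta> and n = j] \<beta> by (auto intro!: mult_left_mono less_imp_le)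
    then show ?thesis
      using R[OF that] unfolding digit_def by (auto intro!: floor_mono)
  qed
  then have "(\<lambda>\<alpha>. word \<beta> \<alpha> 0 n) ` K \<subseteq> {xs. set xs \<subseteq> {\<lfloor>- R\<rfloor>..\<lfloor>\<beta> + R\<rfloor>} \<and> length xs = n}"
    unfolding word_def by auto
  then show ?thesis
    by (rule finite_subset) (simp add: finite_lists_length_eq)
qed

text \<open>The number of short pieces at most doubles every \<open>M\<close> steps, so that after \<open>k\<close> such periods there
  are \<open>O(2^k)\<close> of them, while each has length \<open>O(1 / \<beta>^(k * M))\<close>.\<close>

lemma negligible_always_short:
  assumes \<beta>: "1 < \<beta>" and s: "0 < s" "s \<le> 1/2" and M: "2 < \<beta> ^ M" and K: "bounded K" and N: "1 \<le> N"
    and w0: "\<And>\<alpha> z. \<alpha> \<in> K \<Longrightarrow> \<bar>z\<bar> < s \<Longrightarrow> word \<beta> \<alpha> z M = w0"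
    and w1: "\<And>\<alpha> z. \<alpha> \<in> K \<Longrightarrow> \<bar>z - 1\<bar> < s \<Longrightarrow> word \<beta> \<alpha> z M = w1"
  shows "negligible {\<alpha> \<in> K. \<forall>n\<ge>N. \<forall>\<alpha>'\<in>K. word \<beta> \<alpha> 0 n = word \<beta> \<alpha>' 0 n \<longrightarrow>
                       geom \<beta> n * \<bar>\<alpha> - \<alpha>'\<bar> * (\<beta> + 1) < s}"
    (is "negligible ?B")
proof -
  define B where "B = ?B"
  have B_K: "B \<subseteq> K" by (auto simp: B_def)
  have short: "geom \<beta> n * \<bar>\<alpha> - \<alpha>'\<bar> * (\<beta> + 1) < s"
    if "N \<le> n" "\<alpha> \<in> B" "\<alpha>' \<in> B" "word \<beta> \<alpha> 0 n = word \<beta> \<alpha>' 0 n" for n \<alpha> \<alpha>'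
    using that by (auto simp: B_def)
  define W where "W n = (\<lambda>\<alpha>. word \<beta> \<alpha> 0 n) ` B" for n
  have fin: "finite (W n)" for n
    unfolding W_def by (rule finite_words[OF \<beta>]) (rule bounded_subset[OF K B_K])
  have step: "card (W (n + M)) \<le> 2 * card (W n)" if "n \<ge> N" for n
  proof -
    define P where "P w = (\<lambda>\<alpha>. word \<beta> \<alpha> 0 (n + M)) ` {\<alpha> \<in> B. word \<beta> \<alpha> 0 n = w}" for w
    have P: "finite (P w) \<and> card (P w) \<le> 2" for w
    proof -
      have "\<exists>a b. \<forall>\<alpha>\<in>B. word \<beta> \<alpha> 0 n = w \<longrightarrow> word \<beta> \<alpha> 0 (n + M) \<in> {a, b}"
      proof (rule short_piece_two_words[OF \<beta> s])
        show "1 \<le> n" using N that by simp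
        show "word \<beta> \<alpha> z M = w0" if "\<alpha> \<in> B" "\<bar>z\<bar> < s" for \<alpha> z
          using w0 that B_K by blast
        show "word \<beta> \<alpha> z M = w1" if "\<alpha> \<in> B" "\<bar>z - 1\<bar> < s" for \<alpha> z
          using w1 that B_K by blast
        show "geom \<beta> m * \<bar>\<alpha> - \<alpha>'\<bar> * (\<beta> + 1) < s"
          if "n \<le> m" "\<alpha> \<in> B" "\<alpha>' \<in> B" "word \<beta> \<alpha> 0 m = word \<beta> \<alpha>' 0 m" for m \<alpha> \<alpha>'
          using short \<open>N \<le> n\<close> that by simp
      qed
      then obtain a b where "\<forall>\<alpha>\<in>B. word \<beta> \<alpha> 0 n = w \<longrightarrow> word \<beta> \<alpha> 0 (n + M) \<in> {a, b}"
        by blast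
      then have "P w \<subseteq> {a, b}"
        unfolding P_def by blast
      then have "card (P w) \<le> card {a, b}" "finite (P w)"
        by (auto intro: card_mono finite_subset)
      then show ?thesis
        using card_insert_le_m1[of 2 "{b}" a] by simp
    qed
    have "W (n + M) = (\<Union>w\<in>W n. P w)"
      unfolding W_def P_def by blast
    then have "card (W (n + M)) \<le> (\<Sum>w\<in>W n. card (P w))"
      using fin card_UN_le by metis
    also have "\<dots> \<le> (\<Sum>w\<in>W n. 2)"
      using P by (intro sum_mono) auto
    finally show ?thesis by simp
  qed
  have count: "card (W (N + k * M)) \<le> 2 ^ k * card (W N)" for k
  proof (induction k)
    case (Suc k)
    have "card (W (N + Suc k * M)) \<le> 2 * card (W (N + k * M))"
      using step[of "N + k * M"] by (simp add: ac_simps)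
    then show ?case using Suc by simp
  qed simp
  define c where "c = real (card (W N)) * 2 * s"
  have cover: "\<exists>T. B \<subseteq> T \<and> T \<in> lmeasurable \<and> measure lebesgue T \<le> c * (2 / \<beta> ^ M) ^ k" for k
  proof -
    define n where "n = N + k * M"
    have n: "n \<ge> 1" "n \<ge> N" using N by (auto simp: n_def)
    have g: "geom \<beta> n \<ge> 1" using geom_ge_1[OF \<beta> n(1)] .
    have "\<forall>w\<in>W n. \<exists>\<alpha>\<in>B. w = word \<beta> \<alpha> 0 n"
      unfolding W_def by blast
    then obtain rep where rep: "\<And>w. w \<in> W n \<Longrightarrow> rep w \<in> B" "\<And>w. w \<in> W n \<Longrightarrow> w = word \<beta> (rep w) 0 n"
      by metis
    define T where "T = (\<Union>w\<in>W n. cball (rep w) (s / geom \<beta> n))"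
    have "B \<subseteq> T"
    proof
      fix \<alpha> assume \<alpha>: "\<alpha> \<in> B"
      define w where "w = word \<beta> \<alpha> 0 n"
      have w: "w \<in> W n" using \<alpha> unfolding w_def W_def by blast
      have "geom \<beta> n * \<bar>\<alpha> - rep w\<bar> * (\<beta> + 1) < s"
        using \<alpha> rep[OF w] n by (intro short) (auto simp: w_def)
      moreover have "geom \<beta> n * \<bar>\<alpha> - rep w\<bar> * 1 \<le> geom \<beta> n * \<bar>\<alpha> - rep w\<bar> * (\<beta> + 1)"
        using g \<beta> by (intro mult_left_mono) auto
      ultimately have "\<bar>\<alpha> - rep w\<bar> \<le> s / geom \<beta> n"
        using g by (simp add: field_simps)
      then show "\<alpha> \<in> T"
        using w unfolding T_def by (auto simp: dist_real_def abs_minus_commute)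
    qed
    moreover have "T \<in> lmeasurable"
      using fin unfolding T_def by (intro fmeasurable.finite_UN) auto
    moreover have "measure lebesgue T \<le> c * (2 / \<beta> ^ M) ^ k"
    proof -
      have "measure lebesgue T \<le> (\<Sum>w\<in>W n. measure lebesgue (cball (rep w) (s / geom \<beta> n)))"
        using fin unfolding T_def by (intro measure_UNION_le) auto
      also have "\<dots> = card (W n) * (2 * s / geom \<beta> n)"
        using s g by (simp add: cball_eq_atLeastAtMost)
      also have "\<dots> \<le> real (2 ^ k * card (W N)) * (2 * s / \<beta> ^ (k * M))"
      proof (intro mult_mono)
        show "real (card (W n)) \<le> real (2 ^ k * card (W N))"
          using count[of k] unfolding n_def by (rule of_nat_mono)
        have "\<beta> ^ (k * M) \<le> \<beta> ^ (n - 1)"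
          using \<beta> N by (intro power_increasing) (auto simp: n_def)
        also have "\<dots> \<le> geom \<beta> n"
          using geom_ge_power[OF \<beta>, of "n - 1"] n by simp
        finally show "2 * s / geom \<beta> n \<le> 2 * s / \<beta> ^ (k * M)"
          using s \<beta> g by (intro divide_left_mono) auto
      qed (use s g in auto)
      also have "\<dots> = c * (2 / \<beta> ^ M) ^ k"
        by (simp add: c_def power_divide power_mult mult.commute[of k M])
      finally show ?thesis .
    qed
    ultimately show ?thesis by blast
  qed
  have "negligible B"
    unfolding negligible_outer_le
  proof (intro allI impI)
    fix e :: real assume "e > 0"
    have "(\<lambda>k. c * (2 / \<beta> ^ M) ^ k) \<longlonglongrightarrow> c * 0"
      using M by (intro tendsto_intros LIMSEQ_power_zero) auto
    then have "\<forall>\<^sub>F k in sequentially. c * (2 / \<beta> ^ M) ^ k < e"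
      using \<open>e > 0\<close> by (auto dest: order_tendstoD)
    then obtain k where k: "c * (2 / \<beta> ^ M) ^ k < e"
      by (auto simp: eventually_sequentially)
    then show "\<exists>T. B \<subseteq> T \<and> T \<in> lmeasurable \<and> measure lebesgue T \<le> e"
      using cover[of k] by (meson less_imp_le order_trans)
  qed
then show ?thesis by (simp add: B_def)
qed


text \<open>The length of the image, under \<open>\<alpha> \<mapsto> G\<^sub>\<alpha>\<^sup>n(0)\<close>, of the branch around \<open>\<alpha>\<close> stays
  away from 0 along a subsequence. It is measured from the image of \<open>\<alpha>\<close> itself, through a second
  parameter with the same word.\<close>

definition large_images :: "real \<Rightarrow> real \<Rightarrow> bool" where
  "large_images \<beta> \<alpha> \<longleftrightarrow> (\<exists>\<delta>>0. \<exists>\<^sub>\<infinity>n. \<exists>\<alpha>'. word \<beta> \<alpha> 0 n = word \<beta> \<alpha>' 0 n \<and> \<delta> \<le> geom \<beta> n * \<bar>\<alpha>' - \<alpha>\<bar>)"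

text \<open>Both one-sided orbits of the discontinuity never return to it: the orbit of \<open>1\<close> stands for the
  left limit at the discontinuity, and as long as it avoids \<open>0\<close> it agrees with that limit.\<close>

definition zero_free :: "real \<Rightarrow> real \<Rightarrow> bool" where
  "zero_free \<beta> \<alpha> \<longleftrightarrow> (\<forall>j\<ge>1. (gbeta \<alpha> \<beta> ^^ j) 0 \<noteq> 0 \<and> (gbeta \<alpha> \<beta> ^^ j) 1 \<noteq> 0)"

lemma negligible_not_zero_free:
  assumes \<beta>: "1 < \<beta>"
  shows "negligible {\<alpha>. \<not> zero_free \<beta> \<alpha>}"
proof -
  have "{\<alpha>. \<not> zero_free \<beta> \<alpha>} = {\<alpha>. \<exists>j\<ge>1. (gbeta \<alpha> \<beta> ^^ j) 0 = 0} \<union> {\<alpha>. \<exists>j\<ge>1. (gbeta \<alpha> \<beta> ^^ j) 1 = 0}"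
    by (auto simp: zero_free_def)
  then have "countable {\<alpha>. \<not> zero_free \<beta> \<alpha>}"
    using countable_hit_zero[OF \<beta>] by simp
  then show ?thesis
    by (simp add: negligible_iff_null_sets null_sets_completionI countable_imp_null_set_lborel)
qed

lemma zero_free_stable:
  assumes \<beta>: "1 < \<beta>" and "zero_free \<beta> \<alpha>"
  obtains s where "0 < s" "s \<le> 1/2"
    "\<And>\<alpha>' z. \<bar>\<alpha>' - \<alpha>\<bar> < s \<Longrightarrow> \<bar>z\<bar> < s \<Longrightarrow> word \<beta> \<alpha>' z M = word \<beta> \<alpha> 0 M"
    "\<And>\<alpha>' z. \<bar>\<alpha>' - \<alpha>\<bar> < s \<Longrightarrow> \<bar>z - 1\<bar> < s \<Longrightarrow> word \<beta> \<alpha>' z M = word \<beta> \<alpha> 1 M"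
proof -
  obtain s0 where s0: "s0 > 0"
    "\<And>\<alpha>' z. \<bar>\<alpha>' - \<alpha>\<bar> < s0 \<Longrightarrow> \<bar>z - 0\<bar> < s0 \<Longrightarrow> word \<beta> \<alpha>' z M = word \<beta> \<alpha> 0 M"
    using iterate_stable[OF \<beta>, of M \<alpha> 0 1] assms(2) unfolding zero_free_def by auto
  obtain s1 where s1: "s1 > 0"
    "\<And>\<alpha>' z. \<bar>\<alpha>' - \<alpha>\<bar> < s1 \<Longrightarrow> \<bar>z - 1\<bar> < s1 \<Longrightarrow> word \<beta> \<alpha>' z M = word \<beta> \<alpha> 1 M"
    using iterate_stable[OF \<beta>, of M \<alpha> 1 1] assms(2) unfolding zero_free_def by auto
  show ?thesis
  proof (rule that[of "min (1/2) (min s0 s1)"])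
    show "word \<beta> \<alpha>' z M = word \<beta> \<alpha> 0 M"
      if "\<bar>\<alpha>' - \<alpha>\<bar> < min (1/2) (min s0 s1)" "\<bar>z\<bar> < min (1/2) (min s0 s1)" for \<alpha>' z
      using that by (intro s0(2)) auto
    show "word \<beta> \<alpha>' z M = word \<beta> \<alpha> 1 M"
      if "\<bar>\<alpha>' - \<alpha>\<bar> < min (1/2) (min s0 s1)" "\<bar>z - 1\<bar> < min (1/2) (min s0 s1)" for \<alpha>' z
      using that by (intro s1(2)) auto
  qed (use s0(1) s1(1) in auto)
qed

text \<open>Around a parameter with non-recurrent discontinuity, the itineraries of length \<open>M\<close> next to the
  discontinuity are locally constant, so the counting of short pieces applies on a neighbourhood.\<close>

lemma negligible_not_large_images:
  assumes \<beta>: "1 < \<beta>"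
  shows "negligible {\<alpha>. \<not> large_images \<beta> \<alpha>}"
proof -
  define S where "S = {\<alpha>. zero_free \<beta> \<alpha> \<and> \<not> large_images \<beta> \<alpha>}"
  obtain M where M: "2 < \<beta> ^ M" using real_arch_pow[OF \<beta>] by blast
  have "negligible S"
    unfolding locally_negligible_alt[of S]
  proof
    fix \<alpha> assume \<alpha>: "\<alpha> \<in> S"
    then have zf: "zero_free \<beta> \<alpha>" by (simp add: S_def)
    obtain s where s: "0 < s" "s \<le> 1/2"
      "\<And>\<alpha>' z. \<bar>\<alpha>' - \<alpha>\<bar> < s \<Longrightarrow> \<bar>z\<bar> < s \<Longrightarrow> word \<beta> \<alpha>' z M = word \<beta> \<alpha> 0 M"
      "\<And>\<alpha>' z. \<bar>\<alpha>' - \<alpha>\<bar> < s \<Longrightarrow> \<bar>z - 1\<bar> < s \<Longrightarrow> word \<beta> \<alpha>' z M = word \<beta> \<alpha> 1 M"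
      by (rule zero_free_stable[OF \<beta> zf, where M = M]) (rule that)
    define K where "K = ball \<alpha> s"
    have K: "\<bar>\<alpha>' - \<alpha>\<bar> < s" if "\<alpha>' \<in> K" for \<alpha>'
      using that by (simp add: K_def dist_real_def abs_minus_commute)
    define B where "B N = {\<alpha> \<in> K. \<forall>n\<ge>N. \<forall>\<alpha>'\<in>K. word \<beta> \<alpha> 0 n = word \<beta> \<alpha>' 0 n \<longrightarrow>
                       geom \<beta> n * \<bar>\<alpha> - \<alpha>'\<bar> * (\<beta> + 1) < s}" for N
    have "negligible (B (Suc N))" for N
      unfolding B_def by (rule negligible_always_short[OF \<beta> s(1,2) M _ _ s(3) s(4)]) (auto simp: K_def dist_real_def)
    then have neg: "negligible (\<Union>N. B (Suc N))"
      by (intro negligible_countable_Union) auto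
    have "S \<inter> K \<subseteq> (\<Union>N. B (Suc N))"
    proof (rule subsetI, rule ccontr)
      fix \<gamma> assume \<gamma>: "\<gamma> \<in> S \<inter> K" and "\<gamma> \<notin> (\<Union>N. B (Suc N))"
      then have "\<exists>n\<ge>Suc N. \<exists>\<alpha>'. word \<beta> \<gamma> 0 n = word \<beta> \<alpha>' 0 n \<and> s / (\<beta> + 1) \<le> geom \<beta> n * \<bar>\<alpha>' - \<gamma>\<bar>" for N
        using \<beta> by (fastforce simp: B_def field_simps not_less abs_minus_commute)
      then have "\<exists>\<^sub>\<infinity>n. \<exists>\<alpha>'. word \<beta> \<gamma> 0 n = word \<beta> \<alpha>' 0 n \<and> s / (\<beta> + 1) \<le> geom \<beta> n * \<bar>\<alpha>' - \<gamma>\<bar>"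
        unfolding INFM_nat by (meson Suc_le_eq)
      then have "large_images \<beta> \<gamma>"
        unfolding large_images_def using s(1) \<beta> by (intro exI[of _ "s / (\<beta> + 1)"]) auto
      then show False using \<gamma> by (simp add: S_def)
    qed
    then have "negligible (S \<inter> K)" using neg negligible_subset by blast
    moreover have "openin (top_of_set S) (S \<inter> K)" "\<alpha> \<in> S \<inter> K"
      using \<alpha> s(1) by (auto simp: K_def)
    ultimately show "\<exists>U. openin (top_of_set S) U \<and> \<alpha> \<in> U \<and> negligible U" by blast
  qed
  then have "negligible (S \<union> {\<alpha>. \<not> zero_free \<beta> \<alpha>})"
    using negligible_not_zero_free[OF \<beta>] by simp
  then show ?thesis
    by (rule negligible_subset) (auto simp: S_def)
qed

section \<open>The least invariant union of intervals\<close>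

lemma gbeta_preimage:
  assumes "1 < \<beta>" "0 \<le> y" "y < 1"
  shows "gbeta \<alpha> \<beta> ((y + of_int k - \<alpha>) / \<beta>) = y"
proof -
  have "\<beta> * ((y + of_int k - \<alpha>) / \<beta>) + \<alpha> = y + of_int k"
    using assms(1) by simp
  then show ?thesis
    using assms(2,3) unfolding gbeta_def by (simp add: frac_eq)
qed

text \<open>One step of the growth of an interval: either no integer is interior to its image under
  \<open>x \<mapsto> \<beta> * x + \<alpha>\<close>, which then remains an interval modulo 1, or the image is cut there into
  neighbourhoods of the two ends of \<open>[0,1)\<close>.\<close>

lemma interval_image_or_cut:
  assumes \<beta>: "1 < \<beta>" and inv: "gbeta \<alpha> \<beta> ` W \<subseteq> W" and sub: "{c..<c + l} \<subseteq> W" and l: "0 < l"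
  shows "(\<exists>c'. {c'..<c' + \<beta> * l} \<subseteq> W) \<or>
    (\<exists>g h. 0 < g \<and> g \<le> 1 \<and> 0 < h \<and> h \<le> 1 \<and> min 1 (\<beta> * l) \<le> g + h \<and> {0..<g} \<subseteq> W \<and> {1 - h..<1} \<subseteq> W)"
proof -
  define v where "v = \<beta> * c + \<alpha>"
  define k where "k = \<lfloor>v\<rfloor> + 1"
  have k: "v < of_int k" "of_int k \<le> v + 1" by (auto simp: k_def)
  have hit: "y \<in> W" if "0 \<le> y" "y < 1" "v \<le> y + of_int i" "y + of_int i < v + \<beta> * l" for y i
  proof -
    have "(y + of_int i - \<alpha>) / \<beta> \<in> {c..<c + l}"
      using that(3,4) \<beta> by (simp add: v_def field_simps)
    then show ?thesis
      using sub inv gbeta_preimage[OF \<beta> that(1,2), of \<alpha> i] by (metis image_subset_iff subsetD)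
  qed
  show ?thesis
  proof (cases "of_int k < v + \<beta> * l")
    case True
    define g h where "g = min 1 (v + \<beta> * l - of_int k)" and "h = of_int k - v"
    have "0 < g \<and> g \<le> 1 \<and> 0 < h \<and> h \<le> 1 \<and> min 1 (\<beta> * l) \<le> g + h"
      using True k by (auto simp: g_def h_def)
    moreover have "{0..<g} \<subseteq> W"
    proof
      fix y assume "y \<in> {0..<g}"
      then show "y \<in> W"
        using k by (intro hit[of y k]) (auto simp: g_def)
    qed
    moreover have "{1 - h..<1} \<subseteq> W"
    proof
      fix y assume "y \<in> {1 - h..<1}"
      then show "y \<in> W"
        using True k by (intro hit[of y "k - 1"]) (auto simp: h_def)
    qed
    ultimately show ?thesis by blast
  next
    case False
    have "{(v - of_int (k - 1))..<(v - of_int (k - 1)) + \<beta> * l} \<subseteq> W"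
    proof
      fix y assume "y \<in> {(v - of_int (k - 1))..<(v - of_int (k - 1)) + \<beta> * l}"
      then show "y \<in> W"
        using False k by (intro hit[of y "k - 1"]) auto
    qed
    then show ?thesis by blast
  qed
qed

text \<open>An interval that is never cut would grow by the factor \<open>\<beta>\<close> forever. When the cut
  comes, the two ends together are at least as long as the initial interval, which the doubling
  argument for a uniform end relies on.\<close>

lemma invariant_contains_both_ends:
  assumes \<beta>: "1 < \<beta>" and inv: "gbeta \<alpha> \<beta> ` W \<subseteq> W" and W: "W \<subseteq> {0..1}"
    and sub: "{c..<c + l} \<subseteq> W" and l: "0 < l"
  obtains g h where "0 < g" "g \<le> 1" "0 < h" "h \<le> 1" "l \<le> g + h" "{0..<g} \<subseteq> W" "{1 - h..<1} \<subseteq> W"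
proof (rule ccontr)
  assume no: "\<not> thesis"
  have len: "a \<le> 1" if "{c..<c + a} \<subseteq> W" for c a
  proof (rule ccontr)
    assume "\<not> a \<le> 1"
    then have "c \<in> {c..<c + a}" "c + (1 + a) / 2 \<in> {c..<c + a}" by auto
    then have "c \<in> {0..1}" "c + (1 + a) / 2 \<in> {0..1}" using that W by blast+
    then have "0 \<le> c" "c + (1 + a) / 2 \<le> 1" by simp_all
    moreover have "1 < (1 + a) / 2" using \<open>\<not> a \<le> 1\<close> by simp
    ultimately show False by linarith
  qed
  have grow: "\<exists>c. {c..<c + \<beta> ^ n * l} \<subseteq> W" for n
  proof (induction n)
    case 0
    then show ?case using sub by auto
  next
    case (Suc n)
    then obtain c' where c': "{c'..<c' + \<beta> ^ n * l} \<subseteq> W" by blast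
    have pos: "0 < \<beta> ^ n * l" using l \<beta> by simp
    from interval_image_or_cut[OF \<beta> inv c' pos] show ?case
    proof
      assume "\<exists>c''. {c''..<c'' + \<beta> * (\<beta> ^ n * l)} \<subseteq> W"
      then show ?thesis by (simp add: mult.assoc)
    next
      assume "\<exists>g h. 0 < g \<and> g \<le> 1 \<and> 0 < h \<and> h \<le> 1 \<and> min 1 (\<beta> * (\<beta> ^ n * l)) \<le> g + h \<and>
        {0..<g} \<subseteq> W \<and> {1 - h..<1} \<subseteq> W"
      then obtain g h where gh: "0 < g" "g \<le> 1" "0 < h" "h \<le> 1" "min 1 (\<beta> * (\<beta> ^ n * l)) \<le> g + h"
        "{0..<g} \<subseteq> W" "{1 - h..<1} \<subseteq> W" by blast
      have "1 * l \<le> \<beta> ^ Suc n * l"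
        using l \<beta> one_le_power[of \<beta> "Suc n"] by (intro mult_right_mono) auto
      then have "l \<le> min 1 (\<beta> * (\<beta> ^ n * l))"
        using len[OF sub] by (simp add: mult.assoc)
      then have "l \<le> g + h" using gh(5) by linarith
      then show ?thesis using that gh no by blast
    qed
  qed
  obtain n where "1 / l < \<beta> ^ n" using real_arch_pow[OF \<beta>] by blast
  then have "1 < \<beta> ^ n * l" using l by (simp add: field_simps)
  then show False using grow[of n] len by (meson not_less)
qed

text \<open>The representative modulo 1 in \<open>[0,1)\<close> makes the map continuous from the right, and every
  iterate is affine on a right neighbourhood of every point.\<close>

lemma right_affine:
  assumes \<beta>: "1 < \<beta>"
  shows "\<exists>e>0. \<forall>h. 0 \<le> h \<longrightarrow> h < e \<longrightarrow>
     (\<forall>j\<le>m. (gbeta \<alpha> \<beta> ^^ j) (x + h) = (gbeta \<alpha> \<beta> ^^ j) x + \<beta> ^ j * h)"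
proof (induction m)
  case 0
  show ?case by (intro exI[of _ 1]) simp
next
  case (Suc m)
  then obtain e where e: "e > 0"
    "\<And>h j. 0 \<le> h \<Longrightarrow> h < e \<Longrightarrow> j \<le> m \<Longrightarrow> (gbeta \<alpha> \<beta> ^^ j) (x + h) = (gbeta \<alpha> \<beta> ^^ j) x + \<beta> ^ j * h"
    by blast
  define v where "v = \<beta> * (gbeta \<alpha> \<beta> ^^ m) x + \<alpha>"
  define e' where "e' = min e ((1 - frac v) / \<beta> ^ Suc m)"
  have "e' > 0" using e \<beta> frac_lt_1[of v] by (simp add: e'_def)
  moreover have "(gbeta \<alpha> \<beta> ^^ Suc m) (x + h) = (gbeta \<alpha> \<beta> ^^ Suc m) x + \<beta> ^ Suc m * h"
    if h: "0 \<le> h" "h < e'" for h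
  proof -
    have "h < (1 - frac v) / \<beta> ^ Suc m" using h by (simp add: e'_def)
    then have lt: "frac v + \<beta> ^ Suc m * h < 1"
      using \<beta> by (simp only: pos_less_divide_eq zero_less_power) (simp add: mult.commute)
    have "\<beta> * (gbeta \<alpha> \<beta> ^^ m) (x + h) + \<alpha> = of_int \<lfloor>v\<rfloor> + (frac v + \<beta> ^ Suc m * h)"
      using e(2)[of h m] h by (simp add: v_def e'_def frac_def algebra_simps)
    moreover have "0 \<le> frac v + \<beta> ^ Suc m * h" using h \<beta> by simp
    ultimately have "frac (\<beta> * (gbeta \<alpha> \<beta> ^^ m) (x + h) + \<alpha>) = frac v + \<beta> ^ Suc m * h"
      using lt by (subst frac_unique_iff) (simp add: Ints_def)
    then show ?thesis unfolding gbeta_Suc_frac v_def .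
  qed
  ultimately show ?case
    using e(2) by (intro exI[of _ e'] conjI allI impI) (auto simp: le_Suc_eq e'_def simp del: funpow.simps)
qed

text \<open>The invariant set that a half-open interval generates. Half-open intervals are the right
  generators because their images are unions of such intervals, whereas the image of a closed
  interval may have an isolated point at \<open>0\<close>.\<close>

definition orbit_of_interval :: "real \<Rightarrow> real \<Rightarrow> real \<Rightarrow> real \<Rightarrow> real set" where
  "orbit_of_interval \<alpha> \<beta> a b = (\<Union>m. (gbeta \<alpha> \<beta> ^^ m) ` {a..<b})"

lemma invariant_interval_unionI:
  assumes "W \<noteq> {}" "W \<subseteq> {0..1}" "gbeta \<alpha> \<beta> ` W \<subseteq> W" "\<And>y. y \<in> W \<Longrightarrow> \<exists>e>0. {y..<y + e} \<subseteq> W"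
  shows "invariant_interval_union \<alpha> \<beta> W"
proof -
  have "\<exists>I. nontrivial_interval I \<and> I \<subseteq> W \<and> y \<in> I" if y: "y \<in> W" for y
  proof -
    obtain e where e: "e > 0" "{y..<y + e} \<subseteq> W" using assms(4)[OF y] by blast
    have "y \<in> {y..<y + e}" "y + e / 2 \<in> {y..<y + e}" "y < y + e / 2"
      using e(1) by auto
    then have "nontrivial_interval {y..<y + e}"
      unfolding nontrivial_interval_def using is_interval_co by blast
    then show ?thesis using e by (intro exI[of _ "{y..<y + e}"]) auto
  qed
  then have "W = \<Union>{I. nontrivial_interval I \<and> I \<subseteq> W}" by blast
  then show ?thesis
    unfolding invariant_interval_union_def using assms(1-3)
    by (intro conjI exI[of _ "{I. nontrivial_interval I \<and> I \<subseteq> W}"]) auto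
qed

lemma orbit_of_interval_invariant:
  assumes \<beta>: "1 < \<beta>" and ab: "0 \<le> a" "a < b" "b \<le> 1"
  shows "invariant_interval_union \<alpha> \<beta> (orbit_of_interval \<alpha> \<beta> a b)"
proof (rule invariant_interval_unionI)
  show "orbit_of_interval \<alpha> \<beta> a b \<noteq> {}"
    using ab by (auto simp: orbit_of_interval_def)
  show "orbit_of_interval \<alpha> \<beta> a b \<subseteq> {0..1}"
  proof
    fix y assume "y \<in> orbit_of_interval \<alpha> \<beta> a b"
    then obtain m x where "y = (gbeta \<alpha> \<beta> ^^ m) x" "x \<in> {a..<b}"
      by (auto simp: orbit_of_interval_def)
    then show "y \<in> {0..1}"
      using ab funpow_gbeta_01[where z = x and \<alpha> = \<alpha> and \<beta> = \<beta> and n = m] by auto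
  qed
  show "gbeta \<alpha> \<beta> ` orbit_of_interval \<alpha> \<beta> a b \<subseteq> orbit_of_interval \<alpha> \<beta> a b"
  proof
    fix y assume "y \<in> gbeta \<alpha> \<beta> ` orbit_of_interval \<alpha> \<beta> a b"
    then obtain m x where "y = (gbeta \<alpha> \<beta> ^^ Suc m) x" "x \<in> {a..<b}"
      by (auto simp: orbit_of_interval_def)
    then show "y \<in> orbit_of_interval \<alpha> \<beta> a b"
      unfolding orbit_of_interval_def by blast
  qed
  fix y assume "y \<in> orbit_of_interval \<alpha> \<beta> a b"
  then obtain m x where y: "y = (gbeta \<alpha> \<beta> ^^ m) x" and x: "x \<in> {a..<b}"
    by (auto simp: orbit_of_interval_def)
  obtain e where e: "e > 0"
    "\<And>h. 0 \<le> h \<Longrightarrow> h < e \<Longrightarrow> (gbeta \<alpha> \<beta> ^^ m) (x + h) = y + \<beta> ^ m * h"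
    using right_affine[OF \<beta>, of m \<alpha> x] unfolding y by blast
  define e' where "e' = min e (b - x)"
  have e': "e' > 0" using e x by (simp add: e'_def)
  have pm: "\<beta> ^ m > 0" using \<beta> by simp
  have "{y..<y + \<beta> ^ m * e'} \<subseteq> orbit_of_interval \<alpha> \<beta> a b"
  proof
    fix z assume z: "z \<in> {y..<y + \<beta> ^ m * e'}"
    define h where "h = (z - y) / \<beta> ^ m"
    have h: "0 \<le> h" "h < e'" using z pm by (simp_all add: h_def field_simps)
    have "z = (gbeta \<alpha> \<beta> ^^ m) (x + h)"
      using e(2)[of h] h \<beta> by (simp add: h_def e'_def)
    moreover have "x + h \<in> {a..<b}" using h x by (auto simp: e'_def)
    ultimately show "z \<in> orbit_of_interval \<alpha> \<beta> a b"
      unfolding orbit_of_interval_def by blast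
  qed
  then show "\<exists>e>0. {y..<y + e} \<subseteq> orbit_of_interval \<alpha> \<beta> a b"
    using e' pm by (intro exI[of _ "\<beta> ^ m * e'"]) simp
qed

lemma invariant_funpow:
  assumes "gbeta \<alpha> \<beta> ` W \<subseteq> W" "x \<in> W"
  shows "(gbeta \<alpha> \<beta> ^^ m) x \<in> W"
  using assms by (induction m) auto

lemma orbit_of_interval_least:
  assumes "gbeta \<alpha> \<beta> ` W \<subseteq> W" "{a..<b} \<subseteq> W"
  shows "orbit_of_interval \<alpha> \<beta> a b \<subseteq> W"
  using invariant_funpow[OF assms(1)] assms(2) unfolding orbit_of_interval_def by blast

lemma invariant_interval_unionD:
  assumes "invariant_interval_union \<alpha> \<beta> W"
  shows "gbeta \<alpha> \<beta> ` W \<subseteq> W" "W \<subseteq> {0..1}" "\<exists>c l. 0 < l \<and> {c..<c + l} \<subseteq> W"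
proof -
  obtain \<I> where I: "\<And>I. I \<in> \<I> \<Longrightarrow> nontrivial_interval I" "\<And>I. I \<in> \<I> \<Longrightarrow> I \<subseteq> {0..1}" "W = \<Union>\<I>"
    and ne: "W \<noteq> {}" and inv: "gbeta \<alpha> \<beta> ` W \<subseteq> W"
    using assms unfolding invariant_interval_union_def by blast
  show "gbeta \<alpha> \<beta> ` W \<subseteq> W" by (rule inv)
  show "W \<subseteq> {0..1}" using I by blast
  obtain J where J: "J \<in> \<I>" using ne I(3) by blast
  then obtain a b where ab: "a \<in> J" "b \<in> J" "a < b" "is_interval J"
    using I(1) unfolding nontrivial_interval_def by blast
  have "{a..<a + (b - a)} \<subseteq> J"
  proof
    fix z assume "z \<in> {a..<a + (b - a)}"
    then have "a \<le> z" "z \<le> b" by auto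
    then show "z \<in> J" by (rule mem_is_interval_1_I[OF ab(4,1,2)])
  qed
  also have "J \<subseteq> W" using J I(3) by blast
  finally show "\<exists>c l. 0 < l \<and> {c..<c + l} \<subseteq> W"
    using ab(3) by (intro exI[of _ a] exI[of _ "b - a"]) simp
qed

lemma invariant_interval_union_ends:
  assumes "1 < \<beta>" "invariant_interval_union \<alpha> \<beta> W"
  obtains g h where "0 < g" "g \<le> 1" "0 < h" "h \<le> 1" "{0..<g} \<subseteq> W" "{1 - h..<1} \<subseteq> W"
proof -
  obtain c l where "0 < l" "{c..<c + l} \<subseteq> W" using invariant_interval_unionD(3)[OF assms(2)] by blast
  then show ?thesis
    by (intro invariant_contains_both_ends[OF assms(1) invariant_interval_unionD(1,2)[OF assms(2)] _ _ that])
qed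

lemma constant_word_image:
  assumes \<beta>: "1 < \<beta>" and inv: "gbeta \<alpha> \<beta> ` W \<subseteq> W" and sub: "{y..<y + a} \<subseteq> W"
    and w: "\<And>z. z \<in> {y..<y + a} \<Longrightarrow> word \<beta> \<alpha> z M = w"
  shows "{(gbeta \<alpha> \<beta> ^^ M) y..<(gbeta \<alpha> \<beta> ^^ M) y + \<beta> ^ M * a} \<subseteq> W"
proof
  fix t assume t: "t \<in> {(gbeta \<alpha> \<beta> ^^ M) y..<(gbeta \<alpha> \<beta> ^^ M) y + \<beta> ^ M * a}"
  have pm: "\<beta> ^ M > 0" using \<beta> by simp
  define z where "z = y + (t - (gbeta \<alpha> \<beta> ^^ M) y) / \<beta> ^ M"
  have z: "z \<in> {y..<y + a}" using t pm by (simp add: z_def field_simps)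
  then have "y \<in> {y..<y + a}" by auto
  then have "word \<beta> \<alpha> z M = word \<beta> \<alpha> y M" using w z by simp
  then have "(gbeta \<alpha> \<beta> ^^ M) z - (gbeta \<alpha> \<beta> ^^ M) y = \<beta> ^ M * (z - y)"
    using iterate_diff[of \<beta> \<alpha> z M \<alpha> y] by simp
  also have "\<dots> = t - (gbeta \<alpha> \<beta> ^^ M) y" using \<beta> by (simp add: z_def)
  finally have "t = (gbeta \<alpha> \<beta> ^^ M) z" by simp
  moreover have "z \<in> W" using z sub by blast
  ultimately show "t \<in> W" using invariant_funpow[OF inv] by blast
qed

text \<open>A one-sided neighbourhood of length \<open>a < s\<close> of the discontinuity is not cut for \<open>M\<close> steps, which
  stretches it by more than \<open>4\<close>; the two ends it is finally cut into have total length at least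
  \<open>4 * a\<close>, so one of them is at least \<open>2 * a\<close> long. Doubling goes on until the length is comparable
  to \<open>s\<close>, which does not depend on the invariant set.\<close>

lemma invariant_large_end:
  assumes \<beta>: "1 < \<beta>" and zf: "zero_free \<beta> \<alpha>"
  obtains d where "0 < d" "d \<le> 1"
    "\<And>W. invariant_interval_union \<alpha> \<beta> W \<Longrightarrow> {0..<d} \<subseteq> W \<or> {1 - d..<1} \<subseteq> W"
proof -
  obtain M where M: "4 < \<beta> ^ M" using real_arch_pow[OF \<beta>] by blast
  obtain s where s: "0 < s" "s \<le> 1/2"
      "\<And>\<alpha>' z. \<bar>\<alpha>' - \<alpha>\<bar> < s \<Longrightarrow> \<bar>z\<bar> < s \<Longrightarrow> word \<beta> \<alpha>' z M = word \<beta> \<alpha> 0 M"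
      "\<And>\<alpha>' z. \<bar>\<alpha>' - \<alpha>\<bar> < s \<Longrightarrow> \<bar>z - 1\<bar> < s \<Longrightarrow> word \<beta> \<alpha>' z M = word \<beta> \<alpha> 1 M"
    by (rule zero_free_stable[OF \<beta> zf, where M = M]) (rule that)
  have double: "{0..<2 * a} \<subseteq> W \<or> {1 - 2 * a..<1} \<subseteq> W"
    if W: "invariant_interval_union \<alpha> \<beta> W" and a: "0 < a" "a < s"
      and sub: "{0..<a} \<subseteq> W \<or> {1 - a..<1} \<subseteq> W" for W a
  proof -
    note inv = invariant_interval_unionD(1,2)[OF W]
    have "\<exists>c. {c..<c + \<beta> ^ M * a} \<subseteq> W"
      using sub
    proof
      assume "{0..<a} \<subseteq> W"
      then have "{0..<0 + a} \<subseteq> W" by simp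
      moreover have "word \<beta> \<alpha> z M = word \<beta> \<alpha> 0 M" if "z \<in> {0..<0 + a}" for z
        using that s(1) a(2) by (intro s(3)) auto
      ultimately have "{(gbeta \<alpha> \<beta> ^^ M) (0)..<(gbeta \<alpha> \<beta> ^^ M) (0) + \<beta> ^ M * a} \<subseteq> W"
        by (rule constant_word_image[OF \<beta> inv(1)])
      then show ?thesis ..
    next
      assume "{1 - a..<1} \<subseteq> W"
      then have "{1 - a..<(1 - a) + a} \<subseteq> W" by simp
      moreover have "word \<beta> \<alpha> z M = word \<beta> \<alpha> 1 M" if "z \<in> {1 - a..<(1 - a) + a}" for z
        using that s(1) a(2) by (intro s(4)) auto
      ultimately have "{(gbeta \<alpha> \<beta> ^^ M) (1 - a)..<(gbeta \<alpha> \<beta> ^^ M) (1 - a) + \<beta> ^ M * a} \<subseteq> W"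
        by (rule constant_word_image[OF \<beta> inv(1)])
      then show ?thesis ..
    qed
    then obtain c where c: "{c..<c + \<beta> ^ M * a} \<subseteq> W" by blast
    have "0 < \<beta> ^ M * a" using \<beta> a by simp
    then obtain g h where gh: "\<beta> ^ M * a \<le> g + h" "{0..<g} \<subseteq> W" "{1 - h..<1} \<subseteq> W"
      by (rule invariant_contains_both_ends[OF \<beta> inv c]) (rule that)
    have "4 * a \<le> \<beta> ^ M * a" using M a by (intro mult_right_mono) auto
    then have "2 * a \<le> g \<or> 2 * a \<le> h" using gh(1) by linarith
    then show ?thesis
    proof
      assume "2 * a \<le> g"
      then have "{0..<2 * a} \<subseteq> {0..<g}" by auto
      then show ?thesis using gh(2) by blast
    next
      assume "2 * a \<le> h"
      then have "{1 - 2 * a..<1} \<subseteq> {1 - h..<1}" by auto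
      then show ?thesis using gh(3) by blast
    qed
  qed
  have main: "{0..<s / 2} \<subseteq> W \<or> {1 - s / 2..<1} \<subseteq> W" if W: "invariant_interval_union \<alpha> \<beta> W" for W
  proof -
    obtain g where g: "0 < g" "{0..<g} \<subseteq> W"
      by (rule invariant_interval_union_ends[OF \<beta> W]) (rule that)
    have grow: "{0..<min (2 ^ n * g) (s / 2)} \<subseteq> W \<or> {1 - min (2 ^ n * g) (s / 2)..<1} \<subseteq> W" for n
    proof (induction n)
      case 0
      have "{0..<min (2 ^ 0 * g) (s / 2)} \<subseteq> {0..<g}" by auto
      then show ?case using g(2) by blast
    next
      case (Suc n)
      define a where "a = min (2 ^ n * g) (s / 2)"
      define a' where "a' = min (2 ^ Suc n * g) (s / 2)"
      have a: "0 < a" "a < s" "a' \<le> 2 * a"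
        using g(1) s(1) by (auto simp: a_def a'_def)
      then have "{0..<a'} \<subseteq> {0..<2 * a}" "{1 - a'..<1} \<subseteq> {1 - 2 * a..<1}" by auto
      then show ?case
        using double[OF W a(1,2)] Suc.IH unfolding a_def[symmetric] a'_def[symmetric] by blast
    qed
    obtain n where "s / 2 / g < 2 ^ n" using real_arch_pow[of 2] by fastforce
    then have "s / 2 \<le> 2 ^ n * g" using g(1) by (simp add: field_simps)
    then have "min (2 ^ n * g) (s / 2) = s / 2" by simp
    then show ?thesis using grow[of n] by simp
  qed
  show ?thesis
    by (rule that[of "s / 2"]) (use s(1,2) main in auto)
qed

text \<open>Two invariant sets share a set of the form \<open>orbit_of_interval \<alpha> \<beta> 0 e\<close>, hence also an end of
  uniform length. If some invariant set lacks the left end, this forces all of them to contain the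
  right end. So one interval lies in every invariant set, and it generates the least one.\<close>

lemma V_set_least:
  assumes \<beta>: "1 < \<beta>" and zf: "zero_free \<beta> \<alpha>"
  shows "invariant_interval_union \<alpha> \<beta> (V_set \<alpha> \<beta>)"
    and "invariant_interval_union \<alpha> \<beta> W \<Longrightarrow> V_set \<alpha> \<beta> \<subseteq> W"
proof -
  obtain d where d: "0 < d" "d \<le> 1"
    "\<And>W. invariant_interval_union \<alpha> \<beta> W \<Longrightarrow> {0..<d} \<subseteq> W \<or> {1 - d..<1} \<subseteq> W"
    by (rule invariant_large_end[OF \<beta> zf]) (rule that)
  have "\<exists>a b. 0 \<le> a \<and> a < b \<and> b \<le> 1 \<and> (\<forall>W. invariant_interval_union \<alpha> \<beta> W \<longrightarrow> {a..<b} \<subseteq> W)"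
  proof (cases "\<forall>W. invariant_interval_union \<alpha> \<beta> W \<longrightarrow> {0..<d} \<subseteq> W")
    case True
    then show ?thesis using d by (intro exI[of _ 0] exI[of _ d]) auto
  next
    case False
    then obtain W0 where W0: "invariant_interval_union \<alpha> \<beta> W0" "\<not> {0..<d} \<subseteq> W0" by blast
    have "{1 - d..<1} \<subseteq> W" if W: "invariant_interval_union \<alpha> \<beta> W" for W
    proof -
      obtain g where g: "0 < g" "g \<le> 1" "{0..<g} \<subseteq> W"
        by (rule invariant_interval_union_ends[OF \<beta> W]) (rule that)
      obtain g0 where g0: "0 < g0" "g0 \<le> 1" "{0..<g0} \<subseteq> W0"
        by (rule invariant_interval_union_ends[OF \<beta> W0(1)]) (rule that)
      define e where "e = min g g0"
      have e: "0 < e" "e \<le> 1" "{0..<e} \<subseteq> W" "{0..<e} \<subseteq> W0"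
        using g g0 by (auto simp: e_def)
      have "orbit_of_interval \<alpha> \<beta> 0 e \<subseteq> W" "orbit_of_interval \<alpha> \<beta> 0 e \<subseteq> W0"
        by (intro orbit_of_interval_least invariant_interval_unionD(1) W W0(1) e(3,4))+
      moreover have "{0..<d} \<subseteq> orbit_of_interval \<alpha> \<beta> 0 e \<or> {1 - d..<1} \<subseteq> orbit_of_interval \<alpha> \<beta> 0 e"
        using orbit_of_interval_invariant[OF \<beta>, of 0 e \<alpha>] e d(3) by blast
      ultimately show ?thesis using W0(2) by blast
    qed
    then show ?thesis using d by (intro exI[of _ "1 - d"] exI[of _ 1]) auto
  qed
  then obtain a b where ab: "0 \<le> a" "a < b" "b \<le> 1"
    "\<And>W. invariant_interval_union \<alpha> \<beta> W \<Longrightarrow> {a..<b} \<subseteq> W" by blast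
  have inv: "invariant_interval_union \<alpha> \<beta> (orbit_of_interval \<alpha> \<beta> a b)"
    by (rule orbit_of_interval_invariant[OF \<beta> ab(1-3)])
  have least: "orbit_of_interval \<alpha> \<beta> a b \<subseteq> W" if "invariant_interval_union \<alpha> \<beta> W" for W
    using orbit_of_interval_least[OF invariant_interval_unionD(1)[OF that] ab(4)[OF that]] .
  have V: "V_set \<alpha> \<beta> = orbit_of_interval \<alpha> \<beta> a b"
    unfolding V_set_def using inv least by (rule Least_equality)
  show "invariant_interval_union \<alpha> \<beta> (V_set \<alpha> \<beta>)" using inv V by simp
  show "invariant_interval_union \<alpha> \<beta> W \<Longrightarrow> V_set \<alpha> \<beta> \<subseteq> W" using least V by simp
qed

lemma orbit_subset_V_set:
  assumes \<beta>: "1 < \<beta>" and zf: "zero_free \<beta> \<alpha>"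
  shows "gbeta_orbit \<alpha> \<beta> 0 \<subseteq> V_set \<alpha> \<beta>"
proof -
  note V = V_set_least(1)[OF \<beta> zf]
  obtain g where g: "0 < g" "{0..<g} \<subseteq> V_set \<alpha> \<beta>"
    by (rule invariant_interval_union_ends[OF \<beta> V]) (rule that)
  then have "0 \<in> V_set \<alpha> \<beta>" by auto
  then have "(gbeta \<alpha> \<beta> ^^ n) 0 \<in> V_set \<alpha> \<beta>" for n
    by (rule invariant_funpow[OF invariant_interval_unionD(1)[OF V]])
  then show ?thesis
    unfolding gbeta_orbit_def by blast
qed

section \<open>Density of the orbit\<close>

text \<open>By minimality, the orbit of the interval reaches \<open>U\<close>. The hit takes place at some point \<open>y\<close>; moving slightly
  to the right of \<open>y\<close> makes the orbit up to time \<open>m\<close> positive, so that it avoids the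
  discontinuity and the hit persists for nearby points and nearby parameters.\<close>

lemma robust_hit:
  assumes \<beta>: "1 < \<beta>" and zf: "zero_free \<beta> \<alpha>" and ab: "0 \<le> a" "a < b" "b \<le> 1"
    and U: "open U" "U \<inter> V_set \<alpha> \<beta> \<noteq> {}"
  obtains m t s where "0 < s" "a \<le> t - s" "t + s \<le> b"
    "\<And>\<gamma> z. \<bar>\<gamma> - \<alpha>\<bar> < s \<Longrightarrow> \<bar>z - t\<bar> < s \<Longrightarrow> (gbeta \<gamma> \<beta> ^^ m) z \<in> U"
proof -
  have "V_set \<alpha> \<beta> \<subseteq> orbit_of_interval \<alpha> \<beta> a b"
    by (rule V_set_least(2)[OF \<beta> zf orbit_of_interval_invariant[OF \<beta> ab]])
  then obtain m y where y: "y \<in> {a..<b}" "(gbeta \<alpha> \<beta> ^^ m) y \<in> U"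
    using U(2) unfolding orbit_of_interval_def by blast
  obtain e where e: "e > 0"
    "\<And>h j. 0 \<le> h \<Longrightarrow> h < e \<Longrightarrow> j \<le> m \<Longrightarrow> (gbeta \<alpha> \<beta> ^^ j) (y + h) = (gbeta \<alpha> \<beta> ^^ j) y + \<beta> ^ j * h"
    using right_affine[OF \<beta>, of m \<alpha> y] by blast
  obtain \<epsilon> where \<epsilon>: "\<epsilon> > 0" "ball ((gbeta \<alpha> \<beta> ^^ m) y) \<epsilon> \<subseteq> U"
    using U(1) y(2) open_contains_ball by blast
  have pm: "\<beta> ^ m > 0" using \<beta> by simp
  obtain h where h: "0 < h" "h < e" "h < b - y" "h < \<epsilon> / \<beta> ^ m"
  proof -
    have "0 < min (min e (b - y)) (\<epsilon> / \<beta> ^ m)"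
      using e(1) \<epsilon>(1) y(1) pm by simp
    then show ?thesis
      using dense[of 0 "min (min e (b - y)) (\<epsilon> / \<beta> ^ m)"] that by auto
  qed
  define t where "t = y + h"
  have t: "a < t" "t < b" using h y(1) by (auto simp: t_def)
  have "(gbeta \<alpha> \<beta> ^^ m) t = (gbeta \<alpha> \<beta> ^^ m) y + \<beta> ^ m * h"
    using e(2)[of h m] h by (simp add: t_def)
  moreover have "\<beta> ^ m * h < \<epsilon>" using h(4) pm by (simp add: field_simps)
  ultimately have "(gbeta \<alpha> \<beta> ^^ m) t \<in> ball ((gbeta \<alpha> \<beta> ^^ m) y) \<epsilon>"
    using h(1) pm by (simp add: dist_real_def)
  then have "(gbeta \<alpha> \<beta> ^^ m) t \<in> U" using \<epsilon> by blast
  then obtain \<epsilon>' where \<epsilon>': "\<epsilon>' > 0" "ball ((gbeta \<alpha> \<beta> ^^ m) t) \<epsilon>' \<subseteq> U"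
    using U(1) open_contains_ball by blast
  have "(gbeta \<alpha> \<beta> ^^ j) t \<noteq> 0" if "1 \<le> j" "j \<le> m" for j
  proof -
    have "0 \<le> (gbeta \<alpha> \<beta> ^^ j) y" using funpow_gbeta_01(1) y(1) ab by auto
    moreover have "0 < \<beta> ^ j * h" using \<beta> h(1) by simp
    ultimately show ?thesis using e(2)[of h j] h that by (simp add: t_def)
  qed
  from iterate_stable[OF \<beta> this \<epsilon>'(1)]
  obtain s where s: "s > 0"
    "\<And>\<gamma> z. \<bar>\<gamma> - \<alpha>\<bar> < s \<Longrightarrow> \<bar>z - t\<bar> < s \<Longrightarrow> \<bar>(gbeta \<gamma> \<beta> ^^ m) z - (gbeta \<alpha> \<beta> ^^ m) t\<bar> < \<epsilon>'"
    by blast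
  define s' where "s' = min s (min (t - a) (b - t))"
  show ?thesis
  proof (rule that[of s' t m])
    show "0 < s'" "a \<le> t - s'" "t + s' \<le> b" using s t by (auto simp: s'_def)
    fix \<gamma> z assume "\<bar>\<gamma> - \<alpha>\<bar> < s'" "\<bar>z - t\<bar> < s'"
    then have "\<bar>(gbeta \<gamma> \<beta> ^^ m) z - (gbeta \<alpha> \<beta> ^^ m) t\<bar> < \<epsilon>'"
      by (intro s(2)) (auto simp: s'_def)
    then have "(gbeta \<gamma> \<beta> ^^ m) z \<in> ball ((gbeta \<alpha> \<beta> ^^ m) t) \<epsilon>'"
      by (simp add: dist_real_def abs_minus_commute)
    then show "(gbeta \<gamma> \<beta> ^^ m) z \<in> U"
      using \<epsilon>'(2) by (rule subsetD[rotated])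
  qed
qed

lemma geom_tendsto_infinity:
  assumes \<beta>: "1 < \<beta>"
  shows "filterlim (geom \<beta>) at_top sequentially"
proof -
  have "filterlim (\<lambda>n. \<beta> ^ n) at_top sequentially"
    using filterlim_realpow_sequentially_gt1[of \<beta>] \<beta>
    by (intro filterlim_at_infinity_imp_filterlim_at_top) (auto intro: always_eventually)
  then have "filterlim (\<lambda>n. geom \<beta> (Suc n)) at_top sequentially"
    by (rule filterlim_at_top_mono) (intro always_eventually allI geom_ge_power[OF \<beta>])
  then show ?thesis by (rule filterlim_sequentially_Suc[THEN iffD1])
qed

text \<open>This replaces the unbounded supply of large images by finitely many intervals, for which the time
  and the size of a robust hit are bounded.\<close>

lemma subinterval_grid:
  fixes lo hi :: real
  assumes "0 \<le> lo" "hi \<le> 1" "2 / real k \<le> hi - lo" "0 < k"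
  shows "\<exists>i<k. lo \<le> real i / real k \<and> (real i + 1) / real k \<le> hi"
proof -
  define i where "i = nat \<lceil>real k * lo\<rceil>"
  have "0 \<le> real k * lo" using assms by simp
  then have i: "real k * lo \<le> real i" "real i < real k * lo + 1"
    unfolding i_def by linarith+
  have "2 \<le> real k * hi - real k * lo"
    using assms(3,4) by (simp add: field_simps)
  moreover have "real k * hi \<le> real k" using assms by (simp add: mult_left_le)
  ultimately have "real i + 1 \<le> real k * hi" "i < k" using i by linarith+
  have "lo \<le> real i / real k"
    using i(1) assms(4) by (simp add: pos_le_divide_eq mult.commute)
  moreover have "(real i + 1) / real k \<le> hi"
    using \<open>real i + 1 \<le> real k * hi\<close> assms(4) by (simp add: pos_divide_le_eq mult.commute)
  ultimately show ?thesis using \<open>i < k\<close> by blast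
qed

text \<open>At infinitely many times \<open>n\<close> the image of the branch around \<open>\<alpha>\<close> contains the same grid interval,
  and with it the window \<open>(t - s, t + s)\<close> from which \<open>U\<close> is hit \<open>m\<close> steps later. As the branch
  is affine with slope \<open>p\<close>, the window pulls back to a hole of length \<open>2 * s / p\<close>; the branch has
  its image in \<open>[0,1)\<close>, so the hole is within distance \<open>r = 1 / p\<close> of \<open>\<alpha>\<close>.\<close>

lemma avoiding_set_porous:
  assumes \<beta>: "1 < \<beta>" and zf: "zero_free \<beta> \<alpha>" and li: "large_images \<beta> \<alpha>"
    and U: "open U" "U \<inter> V_set \<alpha> \<beta> \<noteq> {}"
  shows "\<exists>\<eta>>0. porous_at \<eta> {\<alpha>. \<forall>n. (gbeta \<alpha> \<beta> ^^ n) 0 \<notin> U} \<alpha>"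
proof -
  define X where "X n \<gamma> = (gbeta \<gamma> \<beta> ^^ n) 0" for n \<gamma>
  have X01: "0 \<le> X n \<gamma>" "X n \<gamma> < 1" for n \<gamma>
    using funpow_gbeta_01[of 0] by (auto simp: X_def)
  have X_diff: "X n \<gamma> - X n \<gamma>' = geom \<beta> n * (\<gamma> - \<gamma>')" if "word \<beta> \<gamma> 0 n = word \<beta> \<gamma>' 0 n" for n \<gamma> \<gamma>'
    using iterate_diff[OF that] by (simp add: X_def)
  obtain \<delta> where \<delta>: "\<delta> > 0"
    "\<exists>\<^sub>\<infinity>n. \<exists>\<alpha>'. word \<beta> \<alpha> 0 n = word \<beta> \<alpha>' 0 n \<and> \<delta> \<le> geom \<beta> n * \<bar>\<alpha>' - \<alpha>\<bar>"
    using li unfolding large_images_def by blast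
  obtain k :: nat where k: "2 / \<delta> < real k" using reals_Archimedean2 by blast
  have k0: "0 < k" using k \<delta>(1) by (metis divide_pos_pos less_trans of_nat_0_less_iff zero_less_numeral)
  have k\<delta>: "2 / real k \<le> \<delta>" using k k0 \<delta>(1) by (simp add: field_simps)
  define Q where "Q i n \<longleftrightarrow> (\<exists>\<alpha>'. word \<beta> \<alpha> 0 n = word \<beta> \<alpha>' 0 n \<and>
     min (X n \<alpha>) (X n \<alpha>') \<le> real i / real k \<and> (real i + 1) / real k \<le> max (X n \<alpha>) (X n \<alpha>'))" for i n
  have grid: "\<exists>i\<in>{..<k}. Q i n"
    if ex: "\<exists>\<alpha>'. word \<beta> \<alpha> 0 n = word \<beta> \<alpha>' 0 n \<and> \<delta> \<le> geom \<beta> n * \<bar>\<alpha>' - \<alpha>\<bar>" for n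
  proof -
    obtain \<alpha>' where \<alpha>': "word \<beta> \<alpha> 0 n = word \<beta> \<alpha>' 0 n" "\<delta> \<le> geom \<beta> n * \<bar>\<alpha>' - \<alpha>\<bar>"
      using ex by blast
    have "\<bar>X n \<alpha>' - X n \<alpha>\<bar> = geom \<beta> n * \<bar>\<alpha>' - \<alpha>\<bar>"
      using X_diff[OF \<alpha>'(1)[symmetric]] geom_nonneg[OF \<beta>, of n] by (simp add: abs_mult)
    then have long: "2 / real k \<le> max (X n \<alpha>) (X n \<alpha>') - min (X n \<alpha>) (X n \<alpha>')"
      using \<alpha>'(2) k\<delta> by linarith
    have "0 \<le> min (X n \<alpha>) (X n \<alpha>')" "max (X n \<alpha>) (X n \<alpha>') \<le> 1"
      using X01[of n \<alpha>] X01[of n \<alpha>'] by simp_all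
    from subinterval_grid[OF this long k0] obtain i where "i < k"
        "min (X n \<alpha>) (X n \<alpha>') \<le> real i / real k" "(real i + 1) / real k \<le> max (X n \<alpha>) (X n \<alpha>')"
      by blast
    then have "Q i n"
      using \<alpha>'(1) unfolding Q_def by (intro exI[of _ \<alpha>'] conjI)
    then show ?thesis using \<open>i < k\<close> by blast
  qed
  have "\<exists>\<^sub>\<infinity>n. \<exists>i\<in>{..<k}. Q i n"
    using \<delta>(2) by (rule frequently_elim1) (rule grid)
  then have "\<exists>i\<in>{..<k}. \<exists>\<^sub>\<infinity>n. Q i n"
    by (rule frequently_bex_finite[rotated]) simp
  then obtain i where i: "i < k" "\<exists>\<^sub>\<infinity>n. Q i n"
    by blast
  obtain m t s where s: "0 < s" "real i / real k \<le> t - s" "t + s \<le> (real i + 1) / real k"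
    "\<And>\<gamma> z. \<bar>\<gamma> - \<alpha>\<bar> < s \<Longrightarrow> \<bar>z - t\<bar> < s \<Longrightarrow> (gbeta \<gamma> \<beta> ^^ m) z \<in> U"
  proof -
    have "0 \<le> real i / real k" "real i / real k < (real i + 1) / real k" "(real i + 1) / real k \<le> 1"
      using i(1) k0 by (simp_all add: divide_strict_right_mono)
    then show thesis
      by (rule robust_hit[OF \<beta> zf _ _ _ U]) (rule that)
  qed
  show ?thesis
    unfolding porous_at_def
  proof (rule exI[of _ "2 * s"], intro conjI allI impI)
    show "0 < 2 * s" using s by simp
    fix d :: real assume d: "d > 0"
    have "\<forall>\<^sub>F n in sequentially. 1 / min d s < geom \<beta> n"
      using geom_tendsto_infinity[OF \<beta>] by (rule filterlim_at_top_dense[THEN iffD1, rule_format])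
    then have "\<exists>\<^sub>F n in sequentially. Q i n \<and> 1 / min d s < geom \<beta> n"
      using i(2) by (intro frequently_eventually_frequently) (simp_all add: cofinite_eq_sequentially)
    then obtain n where n: "Q i n" "1 / min d s < geom \<beta> n" by (auto dest: frequently_ex)
    define p where "p = geom \<beta> n"
    define r where "r = 1 / p"
    have "0 < 1 / min d s" using d s(1) by simp
    then have p: "0 < p" using n(2) unfolding p_def by linarith
    have "0 < min d s" using d s(1) by simp
    then have "r < min d s"
      using n(2) p unfolding r_def p_def by (simp only: pos_divide_less_eq mult.commute)
    then have r: "0 < r" "r < d" "r < s"
      using p by (simp_all add: r_def)
    obtain \<alpha>' where \<alpha>': "word \<beta> \<alpha> 0 n = word \<beta> \<alpha>' 0 n"
      "min (X n \<alpha>) (X n \<alpha>') \<le> real i / real k" "(real i + 1) / real k \<le> max (X n \<alpha>) (X n \<alpha>')"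
      using n(1) unfolding Q_def by blast
    define u where "u = \<alpha> + (t - s - X n \<alpha>) / p"
    have hole: "\<gamma> \<in> cball \<alpha> r \<and> X (n + m) \<gamma> \<in> U" if \<gamma>: "\<gamma> \<in> {u<..<u + 2 * s * r}" for \<gamma>
    proof -
      define x where "x = X n \<alpha> + p * (\<gamma> - \<alpha>)"
      have "p * u < p * \<gamma>" "p * \<gamma> < p * (u + 2 * s * r)"
        using \<gamma> p by auto
      moreover have "p * u = p * \<alpha> + (t - s - X n \<alpha>)" "p * (u + 2 * s * r) = p * \<alpha> + (t + s - X n \<alpha>)"
        using p by (simp_all add: u_def r_def field_simps)
      ultimately have x: "\<bar>x - t\<bar> < s"
        by (simp add: x_def algebra_simps abs_less_iff)
      then have between: "min (X n \<alpha>) (X n \<alpha>') < x" "x < max (X n \<alpha>) (X n \<alpha>')"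
        using s(2,3) \<alpha>'(2,3) by linarith+
      have X': "X n \<alpha>' = X n \<alpha> + p * (\<alpha>' - \<alpha>)"
        using X_diff[OF \<alpha>'(1)[symmetric]] by (simp add: p_def)
      have "min 0 (p * (\<alpha>' - \<alpha>)) < p * (\<gamma> - \<alpha>)" "p * (\<gamma> - \<alpha>) < max 0 (p * (\<alpha>' - \<alpha>))"
        using between unfolding x_def X' by linarith+
      then have "p * \<alpha> \<le> p * \<gamma> \<and> p * \<gamma> \<le> p * \<alpha>' \<or> p * \<alpha>' \<le> p * \<gamma> \<and> p * \<gamma> \<le> p * \<alpha>"
        unfolding right_diff_distrib by linarith
      then have "\<alpha> \<le> \<gamma> \<and> \<gamma> \<le> \<alpha>' \<or> \<alpha>' \<le> \<gamma> \<and> \<gamma> \<le> \<alpha>"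
        by (simp only: mult_le_cancel_left_pos[OF p])
      then have w: "word \<beta> \<gamma> 0 n = word \<beta> \<alpha> 0 n"
      proof
        assume "\<alpha> \<le> \<gamma> \<and> \<gamma> \<le> \<alpha>'"
        then show ?thesis by (intro word_convex[OF \<beta> _ _ \<alpha>'(1)]) auto
      next
        assume "\<alpha>' \<le> \<gamma> \<and> \<gamma> \<le> \<alpha>"
        then have "word \<beta> \<gamma> 0 n = word \<beta> \<alpha>' 0 n"
          by (intro word_convex[OF \<beta> _ _ \<alpha>'(1)[symmetric]]) auto
        then show ?thesis using \<alpha>'(1) by (rule trans[OF _ sym])
      qed
      have Xx: "X n \<gamma> = x"
        using X_diff[OF w] by (simp add: x_def p_def)
      have "\<bar>p * (\<gamma> - \<alpha>)\<bar> < 1"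
        using X01[of n \<gamma>] X01[of n \<alpha>] Xx by (simp add: x_def abs_less_iff)
      then have "\<bar>\<gamma> - \<alpha>\<bar> < r"
        using p unfolding abs_mult r_def by (simp add: pos_less_divide_eq mult.commute)
      moreover have "X (n + m) \<gamma> = (gbeta \<gamma> \<beta> ^^ m) (X n \<gamma>)"
        unfolding X_def by (subst add.commute) (simp add: funpow_add)
      ultimately show ?thesis
        using s(4)[of \<gamma> x] x r(3) Xx by (simp add: dist_real_def abs_minus_commute)
    qed
    show "\<exists>r u. 0 < r \<and> r < d \<and> {u<..<u + 2 * s * r} \<subseteq> cball \<alpha> r \<and>
            {u<..<u + 2 * s * r} \<inter> {\<alpha>. \<forall>n. (gbeta \<alpha> \<beta> ^^ n) 0 \<notin> U} = {}"
      using r(1,2) hole unfolding X_def by (intro exI[of _ r] exI[of _ u]) blast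
  qed
qed

text \<open>If the orbit is not dense, it avoids an interval with rational end points that meets the least
  invariant set; the corresponding porous points form a countable union of null sets.\<close>

theorem theorem3p1:
  fixes \<beta> :: real
  assumes "\<beta> > 1"
  shows "AE \<alpha> in lebesgue_on {0..1}.
           gbeta_orbit \<alpha> \<beta> 0 \<subseteq> V_set \<alpha> \<beta> \<and> V_set \<alpha> \<beta> \<subseteq> closure (gbeta_orbit \<alpha> \<beta> 0)"
proof -
  define A where "A U = {\<alpha>. \<forall>n. (gbeta \<alpha> \<beta> ^^ n) 0 \<notin> U}" for U
  define P where "P U = {\<alpha> \<in> A U. \<exists>\<eta>>0. porous_at \<eta> (A U) \<alpha>}" for U
  define E where "E = {\<alpha>. \<not> zero_free \<beta> \<alpha>} \<union> {\<alpha>. \<not> large_images \<beta> \<alpha>} \<union> (\<Union>(p, q)\<in>\<rat> \<times> \<rat>. P {p<..<q})"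
  have "negligible (P U)" for U
    unfolding P_def by (rule negligible_porous_points[of "A U"])
  then have "negligible (\<Union>(p, q)\<in>\<rat> \<times> \<rat>. P {p<..<q})"
    by (intro negligible_countable_Union) (auto intro!: countable_image countable_SIGMA countable_rat)
  then have "negligible E"
    using negligible_not_zero_free[OF assms] negligible_not_large_images[OF assms] by (simp add: E_def)
  then have "negligible (E \<inter> {0..1})"
    by (rule negligible_subset) simp
  then have "E \<inter> {0..1} \<in> null_sets (lebesgue_on {0..1})"
    by (simp add: null_sets_restrict_space negligible_iff_null_sets)
  moreover have "gbeta_orbit \<alpha> \<beta> 0 \<subseteq> V_set \<alpha> \<beta> \<and> V_set \<alpha> \<beta> \<subseteq> closure (gbeta_orbit \<alpha> \<beta> 0)" if "\<alpha> \<notin> E" for \<alpha>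
  proof
    have zf: "zero_free \<beta> \<alpha>" and li: "large_images \<beta> \<alpha>" using that by (auto simp: E_def)
    show "gbeta_orbit \<alpha> \<beta> 0 \<subseteq> V_set \<alpha> \<beta>"
      by (rule orbit_subset_V_set[OF assms zf])
    show "V_set \<alpha> \<beta> \<subseteq> closure (gbeta_orbit \<alpha> \<beta> 0)"
    proof (rule subsetI, rule ccontr)
      fix x assume x: "x \<in> V_set \<alpha> \<beta>" "x \<notin> closure (gbeta_orbit \<alpha> \<beta> 0)"
      then obtain e where e: "e > 0" "\<And>y. y \<in> gbeta_orbit \<alpha> \<beta> 0 \<Longrightarrow> \<not> dist y x < e"
        unfolding closure_approachable by blast
      obtain p where p: "p \<in> \<rat>" "x - e < p" "p < x" using Rats_dense_in_real[of "x - e" x] e(1) by auto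
      obtain q where q: "q \<in> \<rat>" "x < q" "q < x + e" using Rats_dense_in_real[of x "x + e"] e(1) by auto
      have "dist y x < e" if "y \<in> {p<..<q}" for y
        using that p q by (auto simp: dist_real_def)
      then have "\<alpha> \<in> A {p<..<q}"
        using e(2) unfolding A_def gbeta_orbit_def by blast
      moreover have "{p<..<q} \<inter> V_set \<alpha> \<beta> \<noteq> {}" using x(1) p q by auto
      ultimately have "\<alpha> \<in> P {p<..<q}"
        using avoiding_set_porous[OF assms zf li, of "{p<..<q}"] unfolding P_def A_def by simp
      then show False using that p(1) q(1) unfolding E_def by blast
    qed
  qed
  ultimately show ?thesis
    by (intro AE_I'[of "E \<inter> {0..1}"]) (auto simp: space_restrict_space)
qed

end
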